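(* Consider the semi-implicit discrete DLR scheme for the random heat equation described in the context. If $$\bar a(x)\ge a_{\mathrm{stoch}}(x,\xi)\qquad\forall x\in D,\ \xi\in\Gamma,\qquad(\ast)$$ then, for any $\triangle t,h$: (i) for every $0<\kappa<2$, $\displaystyle\|u^N\|_{\mathcal L,\hat\rho}^2\le\|u^0\|_{\mathcal L,\hat\rho}^2+\frac{\triangle t}{\kappa}\sum_{n=0}^{N-1}\|f^{n,n+1}\|_{H,\hat\rho}^2$; (ii) if $f=0$, $\|u^{n+1}\|_{\mathcal L,\hat\rho}\le\|u^n\|_{\mathcal L,\hat\rho}$ for $n=0,\dots,N-1$. Condition $(\ast)$ is satisfied in particular if $a(x,\xi)=\bar a(x)+\sum_{j=1}^Ma_j(x)\xi_j$ with $\Gamma\subset\mathbb R^M$ symmetric, i.e. $\xi\in\Gamma\implies-\xi\in\Gamma$.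
   Context: Setting. $D\subset\mathbb R^d$, $1\le d\le3$, is a polygonal domain, $V=H^1_0(D)$ with $\langle v,w\rangle_V=\int_D\nabla v\cdot\nabla w\,dx$, $H=L^2(D)$, $V'=H^{-1}(D)$, with duality pairing $(\cdot,\cdot)_{V'V}$. $\Gamma$ is the parameter (sample) space, and the diffusion coefficient $a$ satisfies $0<a_{\min}\le a(x,\xi)\le a_{\max}<\infty$ for all $x\in D$, $\xi\in\Gamma$. $\mathcal L(v)=-\nabla\cdot(a\nabla v)$. $\hat\Gamma=\{\omega_1,\dots,\omega_{\hat N}\}\subset\Gamma$ is a finite set with weights $\lambda_k>0$, $\sum_k\lambda_k=1$, $\hat\rho=\sum_k\lambda_k\delta_{\omega_k}$; $L^2_{\hat\rho}$ is the space of real functions on $\hat\Gamma$ with $\langle v,w\rangle_{L^2_{\hat\rho}}=\sum_k\lambda_kv(\omega_k)w(\omega_k)$; $\mathbb E_{\hat\rho}[v]=\sum_k\lambda_kv(\omega_k)$ (also for vector-valued $v$); $v^*=v-\mathbb E_{\hat\rho}[v]$. For $v,w:\hat\Gamma\to V$: $\|v\|_{H,\hat\rho}^2=\sum_k\lambda_k\|v(\omega_k)\|_{L^2(D)}^2$ (also for $v:\hat\Gamma\to H$), $\langle v,w\rangle_{\mathcal L,\hat\rho}=\sum_k\lambda_k\int_Da(x,\omega_k)\nabla v(\omega_k)\cdot\nabla w(\omega_k)\,dx$, $\|v\|_{\mathcal L,\hat\rho}^2=\langle v,v\rangle_{\mathcal L,\hat\rho}$. Decomposition: $a=\bar a+a_{\mathrm{stoch}}$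 with $\bar a=\mathbb E_{\hat\rho}[a]$, $\mathbb E_{\hat\rho}[a_{\mathrm{stoch}}]=0$. Semi-implicit evaluation: $\mathcal L(u^n,u^{n+1})=-\nabla\cdot(\bar a\nabla u^{n+1})-\nabla\cdot(a_{\mathrm{stoch}}\nabla u^n)$. $f^{n,n+1}:\hat\Gamma\to H$ is $f(t_n)$, $f(t_{n+1})$, or any convex combination of both, $f$ being the forcing term. $\triangle t=T/N$, $t_n=n\triangle t$. $V_h\subset V$ is a finite element space of continuous piecewise polynomials of degree $\le r$ on a quasi-uniform family of triangulations, $\dim V_h>R$, $R<\hat N$, with inverse inequality $\sum_k\lambda_k\|\nabla v(\omega_k)\|_{L^2(D)}^2\le\frac{C_I^2}{h^2}\|v\|_{H,\hat\rho}^2$ for all $v:\hat\Gamma\to V_h$. Scheme (one step, from $u^n$ to $u^{n+1}$). Given $u^n=\bar u^n+\sum_{j=1}^RU^n_jY^n_j$ with $\bar u^n,U^n_j\in V_h$, $Y^n_j\in L^2_{\hat\rho}$, $\langle Y^n_i,Y^n_j\rangle_{L^2_{\hat\rho}}=\delta_{ij}$, $\mathbb E_{\hat\rho}[Y^n_j]=0$; write $U=(U_1,\dots,U_R)$, $Y=(Y_1,\dots,Y_R)$ and $G:=\mathcal L(u^n,u^{n+1})-f^{n,n+1}$. 1. $\bar u^{n+1}\in V_h$: $\langle\frac{\bar u^{n+1}-\bar u^n}{\triangle t},v_h\rangle_H+(\mathbb E_{\hat\rho}[G],v_h)_{V'V}=0$ for all $v_h\in V_h$. 2. $\tilde U^{n+1}_j\in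 V_h$: $\langle\frac{\tilde U^{n+1}_j-U^n_j}{\triangle t},v_h\rangle_H+(\mathbb E_{\hat\rho}[G\,Y^n_j],v_h)_{V'V}=0$ for all $v_h\in V_h$, $j=1,\dots,R$. 3. $\tilde Y^{n+1}\in(L^2_{\hat\rho})^R$: $\frac{\tilde Y^{n+1}-Y^n}{\triangle t}\tilde M^{n+1}+\mathcal P^\perp_{\hat\rho,\mathcal Y^n}\big[(G^*,\tilde U^{n+1})_{V'V}\big]=0$, where $\tilde M^{n+1}_{ij}=\langle\tilde U^{n+1}_i,\tilde U^{n+1}_j\rangle_H$, $(G^*,\tilde U^{n+1})_{V'V}$ is the row $((G^*,\tilde U^{n+1}_j)_{V'V})_j$ of elements of $L^2_{\hat\rho}$, and $\mathcal P^\perp_{\hat\rho,\mathcal Y^n}$ is the $L^2_{\hat\rho}$-orthogonal projection onto the orthogonal complement of $\mathcal Y^n=\mathrm{span}\{Y^n_1,\dots,Y^n_R\}$. If $\tilde M^{n+1}$ is singular, $\tilde Y^{n+1}$ is a solution of this equation minimizing $\|\tilde Y^{n+1}-Y^n\|_{L^2_{\hat\rho}}$ (norm on $(L^2_{\hat\rho})^R$). 4. Reorthonormalize: $(U^{n+1},Y^{n+1})$ with $\sum_jY^{n+1}_jU^{n+1}_j=\sum_j\tilde Y^{n+1}_j\tilde U^{n+1}_j$, $\langle Y^{n+1}_i,Y^{n+1}_j\rangle_{L^2_{\hat\rho}}=\delta_{ij}$ (and zero-mean $Y^{n+1}_j$). 5. $u^{n+1}=\bar u^{n+1}+\sum_jU^{n+1}_jY^{n+1}_j$.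 *)

theory Defs
  imports "HOL-Analysis.Analysis" "HOL-Library.Function_Algebras"
begin

section \<open>Function spaces on a domain\<close>

text \<open>Real-valued functions as a vector space; this provides \<open>fun_vs.subspace\<close>,
  \<open>fun_vs.span\<close> and \<open>fun_vs.dim\<close>.\<close>

interpretation fun_vs: vector_space "\<lambda>(c::real) (v :: 'b \<Rightarrow> real) x. c * v x"
  by unfold_locales (auto simp: fun_eq_iff algebra_simps)

text \<open>Elements of \<open>L\<^sup>2(D)\<close> are handled through representatives defined on the whole space;
  the values outside \<open>D\<close> are irrelevant.\<close>

definition L2 :: "(real ^ 'd) set \<Rightarrow> (real ^ 'd \<Rightarrow> 'b::euclidean_space) set" where
  "L2 D = {v. v \<in> borel_measurable (lebesgue_on D) \<and> integrable (lebesgue_on D) (\<lambda>x. (norm (v x))\<^sup>2)}"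

definition L2_inner :: "(real ^ 'd) set \<Rightarrow> (real ^ 'd \<Rightarrow> 'b::euclidean_space) \<Rightarrow> (real ^ 'd \<Rightarrow> 'b) \<Rightarrow> real" where
  "L2_inner D v w = (LINT x|lebesgue_on D. v x \<bullet> w x)"

definition L2_norm :: "(real ^ 'd) set \<Rightarrow> (real ^ 'd \<Rightarrow> 'b::euclidean_space) \<Rightarrow> real" where
  "L2_norm D v = sqrt (L2_inner D v v)"

definition partial :: "'d \<Rightarrow> (real ^ 'd \<Rightarrow> real) \<Rightarrow> real ^ 'd \<Rightarrow> real" where
  "partial i \<phi> x = frechet_derivative \<phi> (at x) (axis i 1)"

definition classical_grad :: "(real ^ 'd \<Rightarrow> real) \<Rightarrow> real ^ 'd \<Rightarrow> real ^ 'd" where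
  "classical_grad \<phi> x = (\<chi> i. partial i \<phi> x)"

primrec Ck :: "nat \<Rightarrow> (real ^ 'd \<Rightarrow> real) \<Rightarrow> bool" where
  "Ck 0 \<phi> = continuous_on UNIV \<phi>"
| "Ck (Suc k) \<phi> = ((\<forall>x. \<phi> differentiable (at x)) \<and> (\<forall>i. Ck k (partial i \<phi>)))"

definition test_functions :: "(real ^ 'd) set \<Rightarrow> (real ^ 'd \<Rightarrow> real) set" where
  "test_functions D = {\<phi>. (\<forall>k. Ck k \<phi>) \<and> (\<exists>K. compact K \<and> K \<subseteq> D \<and> (\<forall>x. x \<notin> K \<longrightarrow> \<phi> x = 0))}"

definition has_weak_grad :: "(real ^ 'd) set \<Rightarrow> (real ^ 'd \<Rightarrow> real) \<Rightarrow> (real ^ 'd \<Rightarrow> real ^ 'd) \<Rightarrow> bool" where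
  "has_weak_grad D v g \<longleftrightarrow> g \<in> L2 D \<and>
     (\<forall>\<phi>\<in>test_functions D. \<forall>i. (LINT x|lebesgue_on D. v x * partial i \<phi> x)
                                = - (LINT x|lebesgue_on D. g x $ i * \<phi> x))"

definition H1 :: "(real ^ 'd) set \<Rightarrow> (real ^ 'd \<Rightarrow> real) set" where
  "H1 D = {v \<in> L2 D. \<exists>g. has_weak_grad D v g}"

text \<open>A representative of the weak gradient, which is unique up to null sets.\<close>

definition weak_grad :: "(real ^ 'd) set \<Rightarrow> (real ^ 'd \<Rightarrow> real) \<Rightarrow> real ^ 'd \<Rightarrow> real ^ 'd" where
  "weak_grad D v = (SOME g. has_weak_grad D v g)"

text \<open>\<open>H\<^sup>1\<^sub>0(D)\<close>: the closure of the test functions in the \<open>H\<^sup>1\<close>-norm.\<close>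

definition H10 :: "(real ^ 'd) set \<Rightarrow> (real ^ 'd \<Rightarrow> real) set" where
  "H10 D = {v \<in> H1 D. \<exists>\<phi>. (\<forall>n. \<phi> n \<in> test_functions D) \<and>
     (\<lambda>n. L2_norm D (\<lambda>x. v x - \<phi> n x)) \<longlonglongrightarrow> 0 \<and>
     (\<lambda>n. L2_norm D (\<lambda>x. weak_grad D v x - classical_grad (\<phi> n) x)) \<longlonglongrightarrow> 0}"

text \<open>Elements of \<open>H\<^sup>-\<^sup>1(D)\<close> are represented as functionals on functions, so that the duality
  pairing is application; \<open>neg_div D b v\<close> is the functional \<open>-\<nabla>\<cdot>(b \<nabla>v)\<close> and an element \<open>f\<close>
  of \<open>L\<^sup>2(D)\<close> acts as \<open>L2_inner D f\<close>.\<close>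

definition neg_div :: "(real ^ 'd) set \<Rightarrow> (real ^ 'd \<Rightarrow> real) \<Rightarrow> (real ^ 'd \<Rightarrow> real) \<Rightarrow> (real ^ 'd \<Rightarrow> real) \<Rightarrow> real" where
  "neg_div D b v w = (LINT x|lebesgue_on D. b x * (weak_grad D v x \<bullet> weak_grad D w x))"


section \<open>Finite element spaces\<close>

text \<open>The condition \<open>interior (closure D) = D\<close> says that \<open>D\<close> does not lie on both sides of its
  boundary (no slits or punctures).\<close>

definition polygonal_domain :: "(real ^ 'd) set \<Rightarrow> bool" where
  "polygonal_domain D \<longleftrightarrow> open D \<and> connected D \<and> bounded D \<and> D \<noteq> {} \<and> interior (closure D) = D \<and>
     (\<exists>F. finite F \<and> (\<forall>P\<in>F. polytope P) \<and> closure D = \<Union>F)"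

definition mesh_of :: "(real ^ 'd) set \<Rightarrow> (real ^ 'd) set set \<Rightarrow> bool" where
  "mesh_of D T \<longleftrightarrow> triangulation T \<and> (\<forall>K\<in>T. int (CARD('d)) simplex K) \<and> \<Union>T = closure D"

text \<open>A family of meshes indexed by the mesh size \<open>h\<close>; every element has diameter at most \<open>h\<close>
  and contains a ball of radius \<open>c h\<close>, with \<open>c\<close> independent of \<open>h\<close> and of the element.\<close>

definition quasi_uniform :: "(real ^ 'd) set \<Rightarrow> real set \<Rightarrow> (real \<Rightarrow> (real ^ 'd) set set) \<Rightarrow> bool" where
  "quasi_uniform D I T \<longleftrightarrow> I \<subseteq> {0<..} \<and>
     (\<forall>h\<in>I. mesh_of D (T h) \<and> h = Max (diameter ` T h)) \<and>
     (\<exists>c>0. \<forall>h\<in>I. \<forall>K\<in>T h. \<exists>z. cball z (c * h) \<subseteq> K)"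

definition poly_deg_le :: "nat \<Rightarrow> (real ^ 'd \<Rightarrow> real) \<Rightarrow> bool" where
  "poly_deg_le r p \<longleftrightarrow> (\<exists>c. \<forall>x. p x = (\<Sum>\<alpha> | (\<Sum>i\<in>UNIV. \<alpha> i) \<le> r. c \<alpha> * (\<Prod>i\<in>UNIV. (x $ i) ^ \<alpha> i)))"

text \<open>An \<open>H\<^sup>1\<^sub>0(D)\<close>-conforming space of continuous piecewise polynomials of degree at most \<open>r\<close>.
  Its elements are normalised to be extended by zero, so that they are determined by their
  restriction to \<open>D\<close> and \<open>fun_vs.dim\<close> is the dimension of the space of functions on \<open>D\<close>.\<close>

definition fe_space :: "(real ^ 'd) set \<Rightarrow> (real ^ 'd) set set \<Rightarrow> nat \<Rightarrow> (real ^ 'd \<Rightarrow> real) set \<Rightarrow> bool" where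
  "fe_space D T r V \<longleftrightarrow> fun_vs.subspace V \<and> V \<subseteq> H10 D \<and>
     (\<forall>v\<in>V. continuous_on (closure D) v \<and> (\<forall>x. x \<notin> D \<longrightarrow> v x = 0) \<and>
        (\<forall>K\<in>T. \<exists>p. poly_deg_le r p \<and> (\<forall>x\<in>K. v x = p x)))"


section \<open>The discrete parameter measure and the diffusion coefficient\<close>

text \<open>\<open>S\<close> is the finite sample set and \<open>lam\<close> the weight function. Functions of the parameter
  are total, but only their values on \<open>S\<close> matter.\<close>

definition discrete_measure :: "'p set \<Rightarrow> 'p set \<Rightarrow> ('p \<Rightarrow> real) \<Rightarrow> bool" where
  "discrete_measure \<Gamma> S lam \<longleftrightarrow> finite S \<and> S \<subseteq> \<Gamma> \<and> (\<forall>\<omega>\<in>S. lam \<omega> > 0) \<and> (\<Sum>\<omega>\<in>S. lam \<omega>) = 1"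

definition expect :: "'p set \<Rightarrow> ('p \<Rightarrow> real) \<Rightarrow> ('p \<Rightarrow> real) \<Rightarrow> real" where
  "expect S lam y = (\<Sum>\<omega>\<in>S. lam \<omega> * y \<omega>)"

definition rho_inner :: "'p set \<Rightarrow> ('p \<Rightarrow> real) \<Rightarrow> ('p \<Rightarrow> real) \<Rightarrow> ('p \<Rightarrow> real) \<Rightarrow> real" where
  "rho_inner S lam y z = (\<Sum>\<omega>\<in>S. lam \<omega> * y \<omega> * z \<omega>)"

text \<open>Norm on \<open>R\<close>-tuples of parameter functions.\<close>

definition rho_norm :: "'p set \<Rightarrow> ('p \<Rightarrow> real) \<Rightarrow> ('r::finite \<Rightarrow> 'p \<Rightarrow> real) \<Rightarrow> real" where
  "rho_norm S lam Z = sqrt (\<Sum>j\<in>UNIV. rho_inner S lam (Z j) (Z j))"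

text \<open>Orthogonal projection onto the orthogonal complement of the subspace \<open>W\<close>; its values are
  uniquely determined on \<open>S\<close>.\<close>

definition proj_perp :: "'p set \<Rightarrow> ('p \<Rightarrow> real) \<Rightarrow> ('p \<Rightarrow> real) set \<Rightarrow> ('p \<Rightarrow> real) \<Rightarrow> 'p \<Rightarrow> real" where
  "proj_perp S lam W q = (SOME w. (\<forall>y\<in>W. rho_inner S lam w y = 0) \<and>
                                  (\<exists>y\<in>W. \<forall>\<omega>\<in>S. q \<omega> = w \<omega> + y \<omega>))"

definition diffusion_coeff :: "(real ^ 'd) set \<Rightarrow> 'p set \<Rightarrow> real \<Rightarrow> real \<Rightarrow> (real ^ 'd \<Rightarrow> 'p \<Rightarrow> real) \<Rightarrow> bool" where
  "diffusion_coeff D \<Gamma> amin amax a \<longleftrightarrow> 0 < amin \<and>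
     (\<forall>x\<in>D. \<forall>\<xi>\<in>\<Gamma>. amin \<le> a x \<xi> \<and> a x \<xi> \<le> amax) \<and>
     (\<forall>\<xi>\<in>\<Gamma>. (\<lambda>x. a x \<xi>) \<in> borel_measurable (lebesgue_on D))"

definition a_bar :: "'p set \<Rightarrow> ('p \<Rightarrow> real) \<Rightarrow> (real ^ 'd \<Rightarrow> 'p \<Rightarrow> real) \<Rightarrow> real ^ 'd \<Rightarrow> real" where
  "a_bar S lam a x = expect S lam (a x)"

definition a_stoch :: "'p set \<Rightarrow> ('p \<Rightarrow> real) \<Rightarrow> (real ^ 'd \<Rightarrow> 'p \<Rightarrow> real) \<Rightarrow> real ^ 'd \<Rightarrow> 'p \<Rightarrow> real" where
  "a_stoch S lam a x \<xi> = a x \<xi> - a_bar S lam a x"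

definition mean_dominates :: "(real ^ 'd) set \<Rightarrow> 'p set \<Rightarrow> 'p set \<Rightarrow> ('p \<Rightarrow> real) \<Rightarrow> (real ^ 'd \<Rightarrow> 'p \<Rightarrow> real) \<Rightarrow> bool" where
  "mean_dominates D \<Gamma> S lam a \<longleftrightarrow> (\<forall>x\<in>D. \<forall>\<xi>\<in>\<Gamma>. a_bar S lam a x \<ge> a_stoch S lam a x \<xi>)"

definition H_rho_norm :: "(real ^ 'd) set \<Rightarrow> 'p set \<Rightarrow> ('p \<Rightarrow> real) \<Rightarrow> ('p \<Rightarrow> real ^ 'd \<Rightarrow> real) \<Rightarrow> real" where
  "H_rho_norm D S lam v = sqrt (\<Sum>\<omega>\<in>S. lam \<omega> * (L2_norm D (v \<omega>))\<^sup>2)"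

definition L_rho_inner :: "(real ^ 'd) set \<Rightarrow> 'p set \<Rightarrow> ('p \<Rightarrow> real) \<Rightarrow> (real ^ 'd \<Rightarrow> 'p \<Rightarrow> real) \<Rightarrow>
    ('p \<Rightarrow> real ^ 'd \<Rightarrow> real) \<Rightarrow> ('p \<Rightarrow> real ^ 'd \<Rightarrow> real) \<Rightarrow> real" where
  "L_rho_inner D S lam a v w = (\<Sum>\<omega>\<in>S. lam \<omega> *
     (LINT x|lebesgue_on D. a x \<omega> * (weak_grad D (v \<omega>) x \<bullet> weak_grad D (w \<omega>) x)))"

definition L_rho_norm :: "(real ^ 'd) set \<Rightarrow> 'p set \<Rightarrow> ('p \<Rightarrow> real) \<Rightarrow> (real ^ 'd \<Rightarrow> 'p \<Rightarrow> real) \<Rightarrow>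
    ('p \<Rightarrow> real ^ 'd \<Rightarrow> real) \<Rightarrow> real" where
  "L_rho_norm D S lam a v = sqrt (L_rho_inner D S lam a v v)"

definition inverse_inequality :: "(real ^ 'd) set \<Rightarrow> 'p set \<Rightarrow> ('p \<Rightarrow> real) \<Rightarrow> (real ^ 'd \<Rightarrow> real) set \<Rightarrow> real \<Rightarrow> real \<Rightarrow> bool" where
  "inverse_inequality D S lam V CI h \<longleftrightarrow> (\<forall>v. (\<forall>\<omega>\<in>S. v \<omega> \<in> V) \<longrightarrow>
     (\<Sum>\<omega>\<in>S. lam \<omega> * (L2_norm D (weak_grad D (v \<omega>)))\<^sup>2) \<le> CI\<^sup>2 / h\<^sup>2 * (H_rho_norm D S lam v)\<^sup>2)"


section \<open>The semi-implicit discrete DLR scheme\<close>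

text \<open>The modes are indexed by a finite type \<open>'r\<close>, so the rank is \<open>R = CARD('r)\<close>.\<close>

definition dlr_fun :: "(real ^ 'd \<Rightarrow> real) \<Rightarrow> ('r::finite \<Rightarrow> real ^ 'd \<Rightarrow> real) \<Rightarrow> ('r \<Rightarrow> 'p \<Rightarrow> real) \<Rightarrow>
    'p \<Rightarrow> real ^ 'd \<Rightarrow> real" where
  "dlr_fun ub U Y \<omega> x = ub x + (\<Sum>j\<in>UNIV. U j x * Y j \<omega>)"

definition dlr_state :: "'p set \<Rightarrow> ('p \<Rightarrow> real) \<Rightarrow> (real ^ 'd \<Rightarrow> real) set \<Rightarrow>
    (real ^ 'd \<Rightarrow> real) \<Rightarrow> ('r::finite \<Rightarrow> real ^ 'd \<Rightarrow> real) \<Rightarrow> ('r \<Rightarrow> 'p \<Rightarrow> real) \<Rightarrow> bool" where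
  "dlr_state S lam V ub U Y \<longleftrightarrow> ub \<in> V \<and> (\<forall>j. U j \<in> V) \<and>
     (\<forall>i j. rho_inner S lam (Y i) (Y j) = (if i = j then 1 else 0)) \<and>
     (\<forall>j. expect S lam (Y j) = 0)"

text \<open>The functional \<open>G(\<omega>) = \<L>(u\<^sup>n, u\<^sup>n\<^sup>+\<^sup>1)(\<omega>) - f(\<omega>)\<close>, with \<open>un\<close>, \<open>un1\<close>, \<open>f\<close> standing for
  \<open>u\<^sup>n\<close>, \<open>u\<^sup>n\<^sup>+\<^sup>1\<close>, \<open>f\<^sup>n\<^sup>,\<^sup>n\<^sup>+\<^sup>1\<close>.\<close>

definition residual :: "(real ^ 'd) set \<Rightarrow> 'p set \<Rightarrow> ('p \<Rightarrow> real) \<Rightarrow> (real ^ 'd \<Rightarrow> 'p \<Rightarrow> real) \<Rightarrow>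
    ('p \<Rightarrow> real ^ 'd \<Rightarrow> real) \<Rightarrow> ('p \<Rightarrow> real ^ 'd \<Rightarrow> real) \<Rightarrow> ('p \<Rightarrow> real ^ 'd \<Rightarrow> real) \<Rightarrow>
    'p \<Rightarrow> (real ^ 'd \<Rightarrow> real) \<Rightarrow> real" where
  "residual D S lam a un un1 f \<omega> w =
     neg_div D (a_bar S lam a) (un1 \<omega>) w + neg_div D (\<lambda>x. a_stoch S lam a x \<omega>) (un \<omega>) w
     - L2_inner D (f \<omega>) w"

definition gram :: "(real ^ 'd) set \<Rightarrow> ('r::finite \<Rightarrow> real ^ 'd \<Rightarrow> real) \<Rightarrow> real ^ 'r ^ 'r" where
  "gram D U = (\<chi> i j. L2_inner D (U i) (U j))"

text \<open>The equation for the stochastic modes \<open>Z\<close>, read as an identity of row vectors at every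
  sample point.\<close>

definition stoch_eq :: "(real ^ 'd) set \<Rightarrow> 'p set \<Rightarrow> ('p \<Rightarrow> real) \<Rightarrow> real \<Rightarrow>
    ('p \<Rightarrow> (real ^ 'd \<Rightarrow> real) \<Rightarrow> real) \<Rightarrow> ('r::finite \<Rightarrow> real ^ 'd \<Rightarrow> real) \<Rightarrow>
    ('r \<Rightarrow> 'p \<Rightarrow> real) \<Rightarrow> ('r \<Rightarrow> 'p \<Rightarrow> real) \<Rightarrow> bool" where
  "stoch_eq D S lam dt G Ut Y Z \<longleftrightarrow> (\<forall>\<omega>\<in>S.
     (\<chi> j. (Z j \<omega> - Y j \<omega>) / dt) v* gram D Ut
     + (\<chi> j. proj_perp S lam (fun_vs.span (range Y))
               (\<lambda>\<eta>. G \<eta> (Ut j) - expect S lam (\<lambda>\<zeta>. G \<zeta> (Ut j))) \<omega>) = 0)"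

definition dlr_step :: "(real ^ 'd) set \<Rightarrow> 'p set \<Rightarrow> ('p \<Rightarrow> real) \<Rightarrow> (real ^ 'd \<Rightarrow> 'p \<Rightarrow> real) \<Rightarrow>
    (real ^ 'd \<Rightarrow> real) set \<Rightarrow> real \<Rightarrow> ('p \<Rightarrow> real ^ 'd \<Rightarrow> real) \<Rightarrow>
    (real ^ 'd \<Rightarrow> real) \<Rightarrow> ('r::finite \<Rightarrow> real ^ 'd \<Rightarrow> real) \<Rightarrow> ('r \<Rightarrow> 'p \<Rightarrow> real) \<Rightarrow>
    (real ^ 'd \<Rightarrow> real) \<Rightarrow> ('r \<Rightarrow> real ^ 'd \<Rightarrow> real) \<Rightarrow> ('r \<Rightarrow> 'p \<Rightarrow> real) \<Rightarrow> bool" where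
  "dlr_step D S lam a V dt f ub U Y ub1 U1 Y1 \<longleftrightarrow>
    (let G = residual D S lam a (dlr_fun ub U Y) (dlr_fun ub1 U1 Y1) f in
     dlr_state S lam V ub U Y \<and> dlr_state S lam V ub1 U1 Y1 \<and>
     (\<forall>v\<in>V. L2_inner D (\<lambda>x. (ub1 x - ub x) / dt) v + expect S lam (\<lambda>\<omega>. G \<omega> v) = 0) \<and>
     (\<exists>Ut Yt.
        (\<forall>j. Ut j \<in> V \<and> (\<forall>v\<in>V. L2_inner D (\<lambda>x. (Ut j x - U j x) / dt) v
                                 + expect S lam (\<lambda>\<omega>. G \<omega> v * Y j \<omega>) = 0)) \<and>
        stoch_eq D S lam dt G Ut Y Yt \<and>
        (\<not> invertible (gram D Ut) \<longrightarrow>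
           (\<forall>Z. stoch_eq D S lam dt G Ut Y Z \<longrightarrow>
              rho_norm S lam (\<lambda>j \<omega>. Yt j \<omega> - Y j \<omega>) \<le> rho_norm S lam (\<lambda>j \<omega>. Z j \<omega> - Y j \<omega>))) \<and>
        (\<forall>\<omega>\<in>S. \<forall>x. (\<Sum>j\<in>UNIV. Y1 j \<omega> * U1 j x) = (\<Sum>j\<in>UNIV. Yt j \<omega> * Ut j x))))"

end

theory Submission imports Defs begin

text \<open>One step of the scheme satisfies a Galerkin equation whose test space contains the increment
  \<open>d = u\<^sup>n\<^sup>+\<^sup>1 - u\<^sup>n\<close>; testing with \<open>d\<close> gives \<open>|d|\<^sup>2 / \<triangle>t + E[G d] = 0\<close>. Writing \<open>P\<close> and \<open>Q\<close>
  for the bilinear forms of the mean and of the fluctuating part of the coefficient, polarisation gives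
  \<open>2 (P(u\<^sup>n\<^sup>+\<^sup>1, d) + Q(u\<^sup>n, d)) = |u\<^sup>n\<^sup>+\<^sup>1|\<^sup>2 - |u\<^sup>n|\<^sup>2 + (P - Q)(d, d)\<close> in the energy norm, and
  \<open>P - Q \<ge> 0\<close> is the condition on the coefficient. Young's inequality absorbs the forcing term into
  \<open>|d|\<^sup>2 / \<triangle>t\<close>, with constant \<open>\<triangle>t / 2\<close>.\<close>

section \<open>Square integrable functions and weak gradients\<close>

text \<open>The increment splits as \<open>(ub1 - ub) + sum_j Y j (Ut j - U j) + sum_j (Yt j - Y j)
  Ut j\<close>. The first two groups are elements of \<open>V\<close> times the orthonormal system
  made of \<open>1\<close> and the \<open>Y j\<close>, and the scheme tests such products directly.
  The last group is admissible if each \<open>Yt j - Y j\<close> is orthogonal to that system, but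
  the equation for the stochastic modes gives this only modulo the kernel of the Gram matrix of
  \<open>Ut\<close>. The obstacle is the rank-deficient case: a combination of the
  \<open>Ut j\<close> of zero \<open>L2\<close> norm must also be invisible to the residual, which
  contains gradients. Hence weak gradients of null functions have to vanish almost everywhere. As
  \<open>weak_grad\<close> is an arbitrary choice of representative, even its linearity holds only
  almost everywhere and needs proof. With these facts, regular and singular Gram matrices are
  treated by one algebraic argument. The constant \<open>dt / 2\<close> arises because the Young
  weight spends all of \<open>|d|^2 / dt\<close>; any \<open>\<kappa> < 2\<close> then only enlarges
  the constant.\<close>

lemma L2_bounded_scaleR:
  fixes v :: "real ^ 'd \<Rightarrow> 'b::euclidean_space"
  assumes D: "D \<in> sets lebesgue" and b: "b \<in> borel_measurable (lebesgue_on D)"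
    and bd: "\<And>x. x \<in> D \<Longrightarrow> \<bar>b x\<bar> \<le> C" and v: "v \<in> L2 D"
  shows "(\<lambda>x. b x *\<^sub>R v x) \<in> L2 D"
proof -
  have vm: "v \<in> borel_measurable (lebesgue_on D)" and vi: "integrable (lebesgue_on D) (\<lambda>x. (norm (v x))\<^sup>2)"
    using v by (auto simp: L2_def)
  have "integrable (lebesgue_on D) (\<lambda>x. (norm (b x *\<^sub>R v x))\<^sup>2)"
  proof (rule Bochner_Integration.integrable_bound)
    show "integrable (lebesgue_on D) (\<lambda>x. C\<^sup>2 * (norm (v x))\<^sup>2)" using vi by simp
    show "(\<lambda>x. (norm (b x *\<^sub>R v x))\<^sup>2) \<in> borel_measurable (lebesgue_on D)" using vm b by measurable
    have "(norm (b x *\<^sub>R v x))\<^sup>2 \<le> C\<^sup>2 * (norm (v x))\<^sup>2" if "x \<in> D" for x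
    proof -
      have "\<bar>b x\<bar>\<^sup>2 \<le> C\<^sup>2" by (rule power_mono[OF bd[OF that]]) simp
      then show ?thesis by (simp add: power_mult_distrib mult_right_mono)
    qed
    then show "AE x in lebesgue_on D. norm ((norm (b x *\<^sub>R v x))\<^sup>2) \<le> norm (C\<^sup>2 * (norm (v x))\<^sup>2)"
      using D by (intro AE_I2) (auto simp: space_restrict_space)
  qed
  then show ?thesis using vm b by (auto simp: L2_def)
qed

lemma L2_scaleR: "v \<in> L2 D \<Longrightarrow> (\<lambda>x. c *\<^sub>R v x) \<in> L2 D"
  by (auto simp: L2_def power_mult_distrib)

lemma L2_cmult: "v \<in> L2 D \<Longrightarrow> (\<lambda>x. c * v x) \<in> L2 D" for v :: "real ^ 'd \<Rightarrow> real"
  using L2_scaleR[of v D c] by simp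

lemma L2_inner_integrable:
  fixes v w :: "real ^ 'd \<Rightarrow> 'b::euclidean_space"
  assumes "v \<in> L2 D" "w \<in> L2 D"
  shows "integrable (lebesgue_on D) (\<lambda>x. v x \<bullet> w x)"
proof (rule Bochner_Integration.integrable_bound)
  show "integrable (lebesgue_on D) (\<lambda>x. (norm (v x))\<^sup>2 + (norm (w x))\<^sup>2)"
    using assms by (auto simp: L2_def)
  show "(\<lambda>x. v x \<bullet> w x) \<in> borel_measurable (lebesgue_on D)"
    using assms by (auto simp: L2_def)
  have "\<bar>v x \<bullet> w x\<bar> \<le> (norm (v x))\<^sup>2 + (norm (w x))\<^sup>2" for x
  proof -
    have "2 * norm (v x) * norm (w x) \<le> (norm (v x))\<^sup>2 + (norm (w x))\<^sup>2"
      by (rule sum_squares_bound)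
    moreover have "0 \<le> norm (v x) * norm (w x)" by simp
    ultimately have "norm (v x) * norm (w x) \<le> (norm (v x))\<^sup>2 + (norm (w x))\<^sup>2"
      by linarith
    then show ?thesis using Cauchy_Schwarz_ineq2[of "v x" "w x"] by linarith
  qed
  then show "AE x in lebesgue_on D. norm (v x \<bullet> w x) \<le> norm ((norm (v x))\<^sup>2 + (norm (w x))\<^sup>2)"
    by (intro AE_I2) (simp add: sum_power2_ge_zero)
qed

lemma L2_add:
  assumes "v \<in> L2 D" "w \<in> L2 D"
  shows "(\<lambda>x. v x + w x) \<in> L2 D"
proof -
  have "integrable (lebesgue_on D) (\<lambda>x. (norm (v x))\<^sup>2 + 2 * (v x \<bullet> w x) + (norm (w x))\<^sup>2)"
    using assms L2_inner_integrable[OF assms] by (auto simp: L2_def)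
  also have "(\<lambda>x. (norm (v x))\<^sup>2 + 2 * (v x \<bullet> w x) + (norm (w x))\<^sup>2) = (\<lambda>x. (norm (v x + w x))\<^sup>2)"
    by (simp add: power2_norm_eq_inner inner_add inner_commute algebra_simps)
  finally show ?thesis using assms by (auto simp: L2_def)
qed

lemma L2_diff: "v \<in> L2 D \<Longrightarrow> w \<in> L2 D \<Longrightarrow> (\<lambda>x. v x - w x) \<in> L2 D"
  using L2_add[OF _ L2_scaleR[of w D "-1"]] by simp

lemma L2_inner_commute: "L2_inner D v w = L2_inner D w v"
  by (simp add: L2_inner_def inner_commute)

lemma L2_inner_self_nonneg: "L2_inner D v v \<ge> 0"
  by (auto simp: L2_inner_def)

lemma L2_norm_power2: "(L2_norm D v)\<^sup>2 = L2_inner D v v"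
  by (simp add: L2_norm_def L2_inner_self_nonneg)

lemma L2_inner_add_right:
  "g \<in> L2 D \<Longrightarrow> v \<in> L2 D \<Longrightarrow> w \<in> L2 D \<Longrightarrow>
    L2_inner D g (\<lambda>x. v x + w x) = L2_inner D g v + L2_inner D g w"
  by (simp add: L2_inner_def inner_add_right L2_inner_integrable)

lemma L2_inner_scaleR_right: "L2_inner D g (\<lambda>x. c *\<^sub>R v x) = c * L2_inner D g v"
  by (simp add: L2_inner_def)

lemma L2_inner_diff_right:
  "g \<in> L2 D \<Longrightarrow> v \<in> L2 D \<Longrightarrow> w \<in> L2 D \<Longrightarrow>
    L2_inner D g (\<lambda>x. v x - w x) = L2_inner D g v - L2_inner D g w"
  by (simp add: L2_inner_def inner_diff_right L2_inner_integrable)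

lemma L2_inner_scaleR_left: "L2_inner D (\<lambda>x. c *\<^sub>R v x) g = c * L2_inner D v g"
  by (simp add: L2_inner_def)

lemma L2_inner_diff_left:
  "g \<in> L2 D \<Longrightarrow> v \<in> L2 D \<Longrightarrow> w \<in> L2 D \<Longrightarrow>
    L2_inner D (\<lambda>x. v x - w x) g = L2_inner D v g - L2_inner D w g"
  by (simp add: L2_inner_def inner_diff_left L2_inner_integrable)

lemma L2_inner_self_eq_0_iff:
  assumes "v \<in> L2 D"
  shows "L2_inner D v v = 0 \<longleftrightarrow> (AE x in lebesgue_on D. v x = 0)"
  using integral_nonneg_eq_0_iff_AE[OF L2_inner_integrable[OF assms assms]]
  by (simp add: L2_inner_def)

text \<open>Expand the square of \<open>w - (t / 2) v\<close> and divide by \<open>t\<close>. The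
  weight is fixed by the later use with \<open>t = dt\<close>: the coefficient of the
  \<open>w\<close> term has to be exactly \<open>1 / dt\<close>.\<close>

lemma L2_young:
  assumes "v \<in> L2 D" "w \<in> L2 D" "(t::real) > 0"
  shows "L2_inner D v w \<le> t / 4 * L2_inner D v v + L2_inner D w w / t"
proof -
  let ?z = "\<lambda>x. w x - (t / 2) *\<^sub>R v x"
  have z: "(\<lambda>x. (t/2) *\<^sub>R v x) \<in> L2 D" "?z \<in> L2 D"
    using assms by (auto intro: L2_diff L2_scaleR)
  have "0 \<le> L2_inner D ?z ?z" by (rule L2_inner_self_nonneg)
  also have "\<dots> = L2_inner D ?z w - t / 2 * L2_inner D ?z v"
    using assms z by (simp add: L2_inner_diff_right L2_inner_scaleR_right)
  also have "\<dots> = L2_inner D w w - t * L2_inner D v w + t\<^sup>2 / 4 * L2_inner D v v"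
    using assms z
    by (simp add: L2_inner_diff_left L2_inner_scaleR_left
        L2_inner_commute[of D w v] power2_eq_square algebra_simps)
  finally have "t * L2_inner D v w \<le> t\<^sup>2 / 4 * L2_inner D v v + L2_inner D w w" by simp
  also have "\<dots> = t * (t / 4 * L2_inner D v v + L2_inner D w w / t)"
    using assms(3) by (simp add: distrib_left power2_eq_square)
  finally show ?thesis using assms(3) by (simp only: mult_le_cancel_left_pos)
qed

text \<open>Young's inequality for \<open>t g\<close> and \<open>w - W n\<close> gives, in the
  limit, a bound of the linear term \<open>t * ?s\<close> by a quadratic one for every real
  \<open>t\<close>, which forces the slope \<open>?s\<close> to vanish.\<close>

lemma L2_inner_eq_0_limit:
  assumes g: "g \<in> L2 D" and w: "w \<in> L2 D" and wn: "\<And>n. W n \<in> L2 D"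
    and orth: "\<And>n::nat. L2_inner D g (W n) = 0"
    and lim: "(\<lambda>n. L2_norm D (\<lambda>x. w x - W n x)) \<longlonglongrightarrow> 0"
  shows "L2_inner D g w = 0"
proof -
  let ?s = "L2_inner D g w" and ?q = "L2_inner D g g"
  have le: "t * ?s \<le> t\<^sup>2 / 4 * ?q" for t
  proof (rule LIMSEQ_le_const)
    show "(\<lambda>n. t\<^sup>2 / 4 * ?q + (L2_norm D (\<lambda>x. w x - W n x))\<^sup>2) \<longlonglongrightarrow> t\<^sup>2 / 4 * ?q"
      using tendsto_add[OF tendsto_const[of "t\<^sup>2 / 4 * ?q"] tendsto_power[OF lim, of 2]] by simp
    have "t * ?s \<le> t\<^sup>2 / 4 * ?q + (L2_norm D (\<lambda>x. w x - W n x))\<^sup>2" for n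
    proof -
      have "t * ?s = L2_inner D (\<lambda>x. t *\<^sub>R g x) (\<lambda>x. w x - W n x)"
        unfolding L2_inner_scaleR_left L2_inner_diff_right[OF g w wn] orth by simp
      also have "\<dots> \<le> 1 / 4 * L2_inner D (\<lambda>x. t *\<^sub>R g x) (\<lambda>x. t *\<^sub>R g x) + (L2_norm D (\<lambda>x. w x - W n x))\<^sup>2"
        using L2_young[of "\<lambda>x. t *\<^sub>R g x" D "\<lambda>x. w x - W n x" 1] g w wn
        by (simp add: L2_scaleR L2_diff L2_norm_power2)
      also have "L2_inner D (\<lambda>x. t *\<^sub>R g x) (\<lambda>x. t *\<^sub>R g x) = t\<^sup>2 * ?q"
        unfolding L2_inner_scaleR_left L2_inner_scaleR_right by (simp add: power2_eq_square)
      finally show ?thesis by simp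
    qed
    then show "\<exists>N. \<forall>n\<ge>N. t * ?s \<le> t\<^sup>2 / 4 * ?q + (L2_norm D (\<lambda>x. w x - W n x))\<^sup>2" by blast
  qed
  have q: "?q \<ge> 0" by (rule L2_inner_self_nonneg)
  \<comment> \<open>Any \<open>t\<close> with the sign of \<open>?s\<close> and small enough
    violates the bound unless \<open>?s = 0\<close>; the \<open>+ 1\<close> keeps the denominator
    positive when \<open>g\<close> is null.\<close>
  define t where "t = ?s / (?q + 1)"
  have st: "?s = t * (?q + 1)" unfolding t_def using q by simp
  have "t * (t * (?q + 1)) \<le> t\<^sup>2 / 4 * ?q" using le[of t] unfolding st .
  then have "t\<^sup>2 * (3 / 4 * ?q + 1) \<le> 0" by (simp add: algebra_simps power2_eq_square)
  moreover have "3 / 4 * ?q + 1 > 0" using q by simp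
  ultimately have "t\<^sup>2 \<le> 0" by (simp add: mult_le_0_iff)
  then show ?thesis using st by simp
qed

section \<open>Test functions and square integrability on a bounded set\<close>

lemma test_function_partial:
  assumes "\<phi> \<in> test_functions D"
  shows "partial i \<phi> \<in> test_functions D"
proof -
  obtain K where K: "compact K" "K \<subseteq> D" "\<And>x. x \<notin> K \<Longrightarrow> \<phi> x = 0"
    using assms by (auto simp: test_functions_def)
  have Ck: "Ck k \<phi>" for k using assms by (auto simp: test_functions_def)
  have "partial i \<phi> x = 0" if "x \<notin> K" for x
  proof -
    \<comment> \<open>Outside \<open>K\<close> the function vanishes on a whole neighbourhood, so
      the same compact set serves for the derivative.\<close>
    have "open (- K)" using K(1) by (simp add: compact_imp_closed open_Compl)
    then have "(\<phi> has_derivative (\<lambda>_. 0)) (at x)"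
      using has_derivative_transform_within_open[of "\<lambda>_. 0" "\<lambda>_. 0" x UNIV "- K" \<phi>] that K(3) by auto
    then show ?thesis by (simp add: partial_def frechet_derivative_at[symmetric])
  qed
  moreover have "Ck k (partial i \<phi>)" for k using Ck[of "Suc k"] by simp
  ultimately show ?thesis using K by (auto simp: test_functions_def)
qed

lemma continuous_in_L2:
  fixes p :: "real ^ 'd \<Rightarrow> real"
  assumes p: "continuous_on UNIV p" and D: "D \<in> sets lebesgue" "bounded D"
  shows "p \<in> L2 D"
proof -
  have "bounded (p ` closure D)"
    using D p by (intro compact_imp_bounded compact_continuous_image) (auto intro: continuous_on_subset)
  then obtain C where C: "\<And>x. x \<in> D \<Longrightarrow> \<bar>p x\<bar> \<le> C"
    by (metis bounded_iff closure_subset imageI real_norm_def subsetD)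
  have "finite_measure (lebesgue_on D)"
    using D by (intro finite_measure_lebesgue_on) (auto intro: bounded_set_imp_lmeasurable)
  \<comment> \<open>\<open>p\<close> is then regarded as a bounded coefficient multiplying the
    constant \<open>1\<close>, which is square integrable because \<open>D\<close> has finite
    measure.\<close>
  then have one: "(\<lambda>x. 1::real) \<in> L2 D"
    using finite_measure.integrable_const[of "lebesgue_on D" "1::real"] by (simp add: L2_def)
  have m: "p \<in> borel_measurable (lebesgue_on D)"
    using p D by (meson continuous_imp_measurable_on_sets_lebesgue continuous_on_subset top_greatest)
  show ?thesis using L2_bounded_scaleR[OF D(1) m C one] by simp
qed

lemma test_function_in_L2:
  "\<phi> \<in> test_functions D \<Longrightarrow> D \<in> sets lebesgue \<Longrightarrow> bounded D \<Longrightarrow> \<phi> \<in> L2 D"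
  by (rule continuous_in_L2) (auto simp: test_functions_def dest: spec[of _ 0])

lemma L2_nth:
  fixes g :: "real ^ 'd \<Rightarrow> real ^ 'n"
  assumes "g \<in> L2 D"
  shows "(\<lambda>x. g x $ i) \<in> L2 D"
proof -
  have "(\<lambda>x. g x \<bullet> axis i 1) \<in> borel_measurable (lebesgue_on D)"
    using assms by (auto simp: L2_def)
  then have m: "(\<lambda>x. g x $ i) \<in> borel_measurable (lebesgue_on D)"
    by (simp add: inner_axis)
  have "integrable (lebesgue_on D) (\<lambda>x. (norm (g x $ i))\<^sup>2)"
  proof (rule Bochner_Integration.integrable_bound)
    show "integrable (lebesgue_on D) (\<lambda>x. (norm (g x))\<^sup>2)" using assms by (auto simp: L2_def)
    show "AE x in lebesgue_on D. norm ((norm (g x $ i))\<^sup>2) \<le> norm ((norm (g x))\<^sup>2)"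
      using power_mono[OF component_le_norm_cart, of "g _" i 2] by simp
  qed (use m in measurable)
  then show ?thesis using m by (auto simp: L2_def)
qed

lemma L2_vec:
  fixes g :: "real ^ 'd \<Rightarrow> real ^ 'n"
  assumes "\<And>i. (\<lambda>x. g x $ i) \<in> L2 D"
  shows "g \<in> L2 D"
proof -
  have eq: "(\<lambda>x. (norm (g x))\<^sup>2) = (\<lambda>x. \<Sum>i\<in>UNIV. (g x $ i)\<^sup>2)"
    by (simp add: norm_vec_def L2_set_def sum_nonneg)
  have "integrable (lebesgue_on D) (\<lambda>x. (norm (g x))\<^sup>2)"
    unfolding eq using assms by (auto simp: L2_def)
  moreover have "g \<in> borel_measurable (lebesgue_on D)"
    using assms by (subst borel_measurable_euclidean_space)
      (auto simp: L2_def Basis_vec_def inner_axis)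
  ultimately show ?thesis by (auto simp: L2_def)
qed


section \<open>Weak gradients: almost-everywhere linearity and null functions\<close>

lemma has_weak_grad_weak_grad: "v \<in> H1 D \<Longrightarrow> has_weak_grad D v (weak_grad D v)"
  unfolding weak_grad_def by (rule someI_ex[of "has_weak_grad D v"]) (auto simp: H1_def)

lemma weak_grad_in_L2: "v \<in> H10 D \<Longrightarrow> weak_grad D v \<in> L2 D"
  using has_weak_grad_weak_grad[of v D] by (simp add: H10_def has_weak_grad_def)

lemma H10_in_L2: "v \<in> H10 D \<Longrightarrow> v \<in> L2 D"
  by (simp add: H10_def H1_def)

lemma weak_grad_by_parts:
  "v \<in> H10 D \<Longrightarrow> \<phi> \<in> test_functions D \<Longrightarrow>
    (LINT x|lebesgue_on D. weak_grad D v x $ i * \<phi> x) = - (LINT x|lebesgue_on D. v x * partial i \<phi> x)"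
  using has_weak_grad_weak_grad[of v D] by (auto simp: H10_def has_weak_grad_def)

lemma classical_grad_in_L2:
  assumes "\<phi> \<in> test_functions D" "D \<in> sets lebesgue" "bounded D"
  shows "classical_grad \<phi> \<in> L2 D"
proof (rule L2_vec)
  fix i
  show "(\<lambda>x. classical_grad \<phi> x $ i) \<in> L2 D"
    using test_function_in_L2[OF test_function_partial[OF assms(1)] assms(2,3), of i]
    by (simp add: classical_grad_def)
qed

lemma L2_mult_integrable:
  fixes v w :: "real ^ 'd \<Rightarrow> real"
  shows "v \<in> L2 D \<Longrightarrow> w \<in> L2 D \<Longrightarrow> integrable (lebesgue_on D) (\<lambda>x. v x * w x)"
  using L2_inner_integrable[of v D w] by simp

text \<open>Partial derivatives of test functions are test functions, so a field orthogonal to all test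
  functions is orthogonal to their gradients and, by density, to all weak gradients. This makes weak
  gradients of elements of \<open>H\<^sup>1\<^sub>0\<close> unique almost everywhere without the fundamental lemma of the
  calculus of variations.\<close>

lemma L2_inner_weak_grad_eq_0:
  assumes D: "D \<in> sets lebesgue" "bounded D" and g: "g \<in> L2 D"
    and orth: "\<And>\<phi> i. \<phi> \<in> test_functions D \<Longrightarrow> (LINT x|lebesgue_on D. g x $ i * \<phi> x) = 0"
    and v: "v \<in> H10 D"
  shows "L2_inner D g (weak_grad D v) = 0"
proof -
  obtain \<phi> where \<phi>: "\<And>n. \<phi> n \<in> test_functions D"
    and lim: "(\<lambda>n. L2_norm D (\<lambda>x. weak_grad D v x - classical_grad (\<phi> n) x)) \<longlonglongrightarrow> 0"
    using v by (auto simp: H10_def)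
  have "L2_inner D g (classical_grad (\<phi> n)) = 0" for n
  proof -
    have p: "partial i (\<phi> n) \<in> test_functions D" for i by (rule test_function_partial[OF \<phi>])
    have "L2_inner D g (classical_grad (\<phi> n))
        = (LINT x|lebesgue_on D. (\<Sum>i\<in>UNIV. g x $ i * partial i (\<phi> n) x))"
      by (simp add: L2_inner_def inner_vec_def classical_grad_def)
    also have "\<dots> = (\<Sum>i\<in>UNIV. LINT x|lebesgue_on D. g x $ i * partial i (\<phi> n) x)"
      using L2_mult_integrable[OF L2_nth[OF g] test_function_in_L2[OF p D]]
      by (intro Bochner_Integration.integral_sum) auto
    also have "\<dots> = 0" using orth[OF p] by simp
    finally show ?thesis .
  qed
  then show ?thesis
    by (rule L2_inner_eq_0_limit[OF g weak_grad_in_L2[OF v] classical_grad_in_L2[OF \<phi> D] _ lim])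
qed

text \<open>Integration by parts makes the linearity defect \<open>g\<close> orthogonal to all test
  functions, hence to all weak gradients of \<open>H10 D\<close>. Since \<open>g\<close> is itself a
  combination of such gradients, it is orthogonal to itself.\<close>

lemma weak_grad_add_scale_AE:
  assumes D: "D \<in> sets lebesgue" "bounded D" and v: "v \<in> H10 D" and w: "w \<in> H10 D"
    and z: "(\<lambda>x. v x + c * w x) \<in> H10 D"
  shows "AE x in lebesgue_on D.
    weak_grad D (\<lambda>x. v x + c * w x) x = weak_grad D v x + c *\<^sub>R weak_grad D w x"
proof -
  let ?z = "\<lambda>x. v x + c * w x"
  define g where "g = (\<lambda>x. weak_grad D ?z x - (weak_grad D v x + c *\<^sub>R weak_grad D w x))"
  have L2: "weak_grad D v \<in> L2 D" "weak_grad D w \<in> L2 D" "weak_grad D ?z \<in> L2 D"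
    using v w z by (auto intro: weak_grad_in_L2)
  then have cw: "(\<lambda>x. c *\<^sub>R weak_grad D w x) \<in> L2 D" by (intro L2_scaleR)
  then have vcw: "(\<lambda>x. weak_grad D v x + c *\<^sub>R weak_grad D w x) \<in> L2 D" using L2 by (intro L2_add)
  then have g: "g \<in> L2 D" unfolding g_def using L2 by (intro L2_diff)
  have orth: "(LINT x|lebesgue_on D. g x $ i * \<phi> x) = 0" if \<phi>: "\<phi> \<in> test_functions D" for \<phi> i
  proof -
    have p: "partial i \<phi> \<in> L2 D" "\<phi> \<in> L2 D"
      using \<phi> D by (auto intro: test_function_in_L2 test_function_partial)
    have i1: "integrable (lebesgue_on D) (\<lambda>x. weak_grad D u x $ i * \<phi> x)" if "u \<in> H10 D" for u
      by (intro L2_mult_integrable L2_nth weak_grad_in_L2 that p)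
    have i2: "integrable (lebesgue_on D) (\<lambda>x. u x * partial i \<phi> x)" if "u \<in> H10 D" for u
      by (intro L2_mult_integrable H10_in_L2 that p)
    have "(LINT x|lebesgue_on D. g x $ i * \<phi> x) = (LINT x|lebesgue_on D. weak_grad D ?z x $ i * \<phi> x
        - (weak_grad D v x $ i * \<phi> x + c * (weak_grad D w x $ i * \<phi> x)))"
      by (simp add: g_def algebra_simps)
    also have "\<dots> = (LINT x|lebesgue_on D. weak_grad D ?z x $ i * \<phi> x)
        - ((LINT x|lebesgue_on D. weak_grad D v x $ i * \<phi> x) + c * (LINT x|lebesgue_on D. weak_grad D w x $ i * \<phi> x))"
      using i1[OF v] i1[OF w] i1[OF z] by simp
    also have "\<dots> = - (LINT x|lebesgue_on D. ?z x * partial i \<phi> x)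
        + ((LINT x|lebesgue_on D. v x * partial i \<phi> x) + c * (LINT x|lebesgue_on D. w x * partial i \<phi> x))"
      by (simp add: weak_grad_by_parts[OF v \<phi>] weak_grad_by_parts[OF w \<phi>] weak_grad_by_parts[OF z \<phi>])
    also have "(LINT x|lebesgue_on D. ?z x * partial i \<phi> x)
        = (LINT x|lebesgue_on D. v x * partial i \<phi> x + c * (w x * partial i \<phi> x))"
      by (simp add: algebra_simps)
    also have "\<dots> = (LINT x|lebesgue_on D. v x * partial i \<phi> x) + c * (LINT x|lebesgue_on D. w x * partial i \<phi> x)"
      using i2[OF v] i2[OF w] by simp
    finally show ?thesis by simp
  qed
  have perp: "L2_inner D g (weak_grad D y) = 0" if "y \<in> H10 D" for y
    using D g orth that by (rule L2_inner_weak_grad_eq_0)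
  have "L2_inner D g g = L2_inner D g (\<lambda>x. weak_grad D ?z x - (weak_grad D v x + c *\<^sub>R weak_grad D w x))"
    by (simp add: g_def)
  also have "\<dots> = 0"
    by (simp only: L2_inner_diff_right[OF g L2(3) vcw] L2_inner_add_right[OF g L2(1) cw]
        L2_inner_scaleR_right perp[OF v] perp[OF w] perp[OF z])
  finally have "AE x in lebesgue_on D. g x = 0" using L2_inner_self_eq_0_iff[OF g] by simp
  then show ?thesis by (simp add: g_def)
qed

text \<open>The gradient of \<open>v\<close> is orthogonal to test functions because integration by
  parts moves the derivative off the null function \<open>v\<close>; it is then orthogonal to every
  weak gradient, its own included. This is what controls a singular Gram matrix.\<close>

lemma weak_grad_eq_0_AE:
  assumes D: "D \<in> sets lebesgue" "bounded D" and v: "v \<in> H10 D"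
    and null: "AE x in lebesgue_on D. v x = 0"
  shows "AE x in lebesgue_on D. weak_grad D v x = 0"
proof -
  have "(LINT x|lebesgue_on D. weak_grad D v x $ i * \<phi> x) = 0" if "\<phi> \<in> test_functions D" for \<phi> i
  proof -
    have "(LINT x|lebesgue_on D. v x * partial i \<phi> x) = 0"
      using null by (intro integral_eq_zero_AE) auto
    then show ?thesis by (simp add: weak_grad_by_parts[OF v that])
  qed
  then have "L2_inner D (weak_grad D v) (weak_grad D v) = 0"
    by (rule L2_inner_weak_grad_eq_0[OF D weak_grad_in_L2[OF v] _ v])
  then show ?thesis using L2_inner_self_eq_0_iff[OF weak_grad_in_L2[OF v]] by simp
qed

section \<open>The bilinear forms with variable coefficient\<close>

lemma neg_div_commute: "neg_div D b v w = neg_div D b w v"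
  by (simp add: neg_div_def inner_commute)

lemma neg_div_integrable:
  assumes "D \<in> sets lebesgue" "b \<in> borel_measurable (lebesgue_on D)"
    "\<And>x. x \<in> D \<Longrightarrow> \<bar>b x\<bar> \<le> C" "v \<in> H10 D" "w \<in> H10 D"
  shows "integrable (lebesgue_on D) (\<lambda>x. b x * (weak_grad D v x \<bullet> weak_grad D w x))"
  using L2_inner_integrable[OF L2_bounded_scaleR[OF assms(1-3) weak_grad_in_L2[OF assms(4)]]
      weak_grad_in_L2[OF assms(5)]] by simp

lemma neg_div_add_coeff:
  assumes "D \<in> sets lebesgue" "v \<in> H10 D" "w \<in> H10 D"
    "b \<in> borel_measurable (lebesgue_on D)" "\<And>x. x \<in> D \<Longrightarrow> \<bar>b x\<bar> \<le> C"
    "b' \<in> borel_measurable (lebesgue_on D)" "\<And>x. x \<in> D \<Longrightarrow> \<bar>b' x\<bar> \<le> C'"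
  shows "neg_div D (\<lambda>x. b x + b' x) v w = neg_div D b v w + neg_div D b' v w"
  using neg_div_integrable[OF assms(1,4,5,2,3)] neg_div_integrable[OF assms(1,6,7,2,3)]
  by (simp add: neg_div_def distrib_right)

lemma neg_div_nonneg:
  assumes "D \<in> sets lebesgue" "\<And>x. x \<in> D \<Longrightarrow> b x \<ge> 0"
  shows "neg_div D b v v \<ge> 0"
  unfolding neg_div_def using assms
  by (intro integral_nonneg_AE AE_I2) (auto simp: space_restrict_space)

text \<open>The exceptional null set in the linearity of \<open>weak_grad\<close> disappears under
  the integral, so the form is exactly linear.\<close>

lemma neg_div_add_scale_right:
  assumes D: "D \<in> sets lebesgue" "bounded D"
    and b: "b \<in> borel_measurable (lebesgue_on D)" "\<And>x. x \<in> D \<Longrightarrow> \<bar>b x\<bar> \<le> C"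
    and u: "u \<in> H10 D" and v: "v \<in> H10 D" and w: "w \<in> H10 D" and z: "(\<lambda>x. v x + c * w x) \<in> H10 D"
  shows "neg_div D b u (\<lambda>x. v x + c * w x) = neg_div D b u v + c * neg_div D b u w"
proof -
  let ?z = "\<lambda>x. v x + c * w x"
  have "neg_div D b u ?z = (LINT x|lebesgue_on D. b x * (weak_grad D u x \<bullet> weak_grad D v x)
      + c * (b x * (weak_grad D u x \<bullet> weak_grad D w x)))"
    unfolding neg_div_def
  proof (rule integral_cong_AE)
    show "AE x in lebesgue_on D. b x * (weak_grad D u x \<bullet> weak_grad D ?z x) =
      b x * (weak_grad D u x \<bullet> weak_grad D v x) + c * (b x * (weak_grad D u x \<bullet> weak_grad D w x))"
      using weak_grad_add_scale_AE[OF D v w z]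
      by eventually_elim (simp add: inner_add_right algebra_simps)
  qed (use neg_div_integrable[OF D(1) b u v] neg_div_integrable[OF D(1) b u w]
      neg_div_integrable[OF D(1) b u z] in auto)
  also have "\<dots> = neg_div D b u v + c * neg_div D b u w"
    using neg_div_integrable[OF D(1) b u v] neg_div_integrable[OF D(1) b u w]
    by (simp add: neg_div_def)
  finally show ?thesis .
qed

lemma neg_div_eq_0_AE:
  assumes "D \<in> sets lebesgue" "bounded D" "v \<in> H10 D" "AE x in lebesgue_on D. v x = 0"
  shows "neg_div D b u v = 0"
  unfolding neg_div_def using weak_grad_eq_0_AE[OF assms]
  by (intro integral_eq_zero_AE) auto

section \<open>The discrete weak formulation\<close>

text \<open>Linearity is asked on \<open>V\<close> only, because the forms are linear only where
  weak gradients exist; the single combination \<open>v + c w\<close> encodes additivity and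
  homogeneity together.\<close>

definition linear_on_space :: "('b \<Rightarrow> real) set \<Rightarrow> (('b \<Rightarrow> real) \<Rightarrow> real) \<Rightarrow> bool" where
  "linear_on_space V L \<longleftrightarrow> (\<forall>v\<in>V. \<forall>w\<in>V. \<forall>c. L (\<lambda>x. v x + c * w x) = L v + c * L w)"

lemma subspace_add_scale:
  assumes V: "fun_vs.subspace V" and vw: "v \<in> V" "w \<in> V"
  shows "(\<lambda>x. v x + c * w x) \<in> V"
  using fun_vs.subspace_add[OF V vw(1) fun_vs.subspace_scale[OF V vw(2), of c]] by (simp add: plus_fun_def)

lemma subspace_sum:
  assumes V: "fun_vs.subspace V" and A: "finite A" "\<And>j. j \<in> A \<Longrightarrow> v j \<in> V"
  shows "(\<lambda>x. \<Sum>j\<in>A. c j * v j x) \<in> V"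
  using A
proof (induction A)
  case empty
  then show ?case using fun_vs.subspace_0[OF V] by (simp add: zero_fun_def)
next
  case (insert j A)
  then show ?case using subspace_add_scale[OF V, of "\<lambda>x. \<Sum>j\<in>A. c j * v j x" "v j" "c j"]
    by (simp add: add.commute)
qed

lemma subspace_diff_fun:
  assumes V: "fun_vs.subspace V" and vw: "v \<in> V" "w \<in> V"
  shows "(\<lambda>x. v x - w x) \<in> V"
  using subspace_add_scale[OF assms, of "-1"] by simp

lemma linear_on_space_sum:
  assumes V: "fun_vs.subspace V" and L: "linear_on_space V L"
    and A: "finite A" "\<And>j. j \<in> A \<Longrightarrow> v j \<in> V"
  shows "L (\<lambda>x. \<Sum>j\<in>A. c j * v j x) = (\<Sum>j\<in>A. c j * L (v j))"
  using A
proof (induction A)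
  case empty
  have "(\<lambda>x. 0) \<in> V" using fun_vs.subspace_0[OF V] by (simp add: zero_fun_def)
  \<comment> \<open>With both arguments zero and \<open>c = 1\<close> the law reads
    \<open>L 0 = L 0 + L 0\<close>.\<close>
  from L[unfolded linear_on_space_def, rule_format, OF this this, of 1] show ?case by simp
next
  case (insert j A)
  then have "(\<lambda>x. \<Sum>j\<in>A. c j * v j x) \<in> V" by (intro subspace_sum[OF V]) auto
  from L[unfolded linear_on_space_def, rule_format, OF this, of "v j" "c j"] insert.prems[of j]
  have "L (\<lambda>x. (\<Sum>j\<in>A. c j * v j x) + c j * v j x) = L (\<lambda>x. \<Sum>j\<in>A. c j * v j x) + c j * L (v j)"
    by simp
  then show ?case using insert by (simp add: add.commute)
qed

lemma linear_on_space_add: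
  assumes "linear_on_space V L" "v \<in> V" "w \<in> V"
  shows "L (\<lambda>x. v x + w x) = L v + L w"
  using assms(1)[unfolded linear_on_space_def, rule_format, OF assms(2,3), of 1] by simp

lemma linear_on_space_diff:
  assumes "linear_on_space V L" "v \<in> V" "w \<in> V"
  shows "L (\<lambda>x. v x - w x) = L v - L w"
  using assms(1)[unfolded linear_on_space_def, rule_format, OF assms(2,3), of "-1"] by simp

text \<open>The coefficients of \<open>W\<close> along \<open>\<psi>\<close> lie in the kernel of the possibly singular Gram matrix of
  the \<open>A\<close>, so they contribute a null element only and \<open>W\<close> acts as if it were orthogonal to \<open>\<psi>\<close>.\<close>

lemma increment_test:
  fixes V :: "('b \<Rightarrow> real) set" and \<psi> :: "'k::finite \<Rightarrow> 'p \<Rightarrow> real" and W :: "'r::finite \<Rightarrow> 'p \<Rightarrow> real"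
  assumes V: "fun_vs.subspace V"
    and B: "\<And>u. u \<in> V \<Longrightarrow> linear_on_space V (B u)" and sym: "\<And>u v. B u v = B v u"
    and G: "\<And>\<omega>. \<omega> \<in> S \<Longrightarrow> linear_on_space V (G \<omega>)"
    and nullB: "\<And>u v. u \<in> V \<Longrightarrow> v \<in> V \<Longrightarrow> B v v = 0 \<Longrightarrow> B u v = 0"
    and nullG: "\<And>\<omega> v. \<omega> \<in> S \<Longrightarrow> v \<in> V \<Longrightarrow> B v v = 0 \<Longrightarrow> G \<omega> v = 0"
    and orth: "\<And>k l. (\<Sum>\<omega>\<in>S. lam \<omega> * \<psi> k \<omega> * \<psi> l \<omega>) = (if k = l then 1 else 0)"
    and X: "\<And>k. X k \<in> V" and A: "\<And>j. A j \<in> V" and dt: "dt \<noteq> 0"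
    and mean: "\<And>k v. v \<in> V \<Longrightarrow> B (X k) v / dt + (\<Sum>\<omega>\<in>S. lam \<omega> * (G \<omega> v * \<psi> k \<omega>)) = 0"
    and stoch: "\<And>\<omega> j. \<omega> \<in> S \<Longrightarrow> (\<Sum>i\<in>UNIV. W i \<omega> * B (A i) (A j)) / dt + q j \<omega> = 0"
    and q: "\<And>\<omega> j. \<omega> \<in> S \<Longrightarrow> q j \<omega> = G \<omega> (A j) - (\<Sum>k\<in>UNIV. e j k * \<psi> k \<omega>)"
    and qorth: "\<And>j k. (\<Sum>\<omega>\<in>S. lam \<omega> * q j \<omega> * \<psi> k \<omega>) = 0"
    and \<delta>: "\<And>\<omega>. \<omega> \<in> S \<Longrightarrow> \<delta> \<omega> = (\<lambda>x. (\<Sum>k\<in>UNIV. \<psi> k \<omega> * X k x) + (\<Sum>i\<in>UNIV. W i \<omega> * A i x))"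
  shows "(\<Sum>\<omega>\<in>S. lam \<omega> * (B (\<delta> \<omega>) (\<delta> \<omega>) / dt + G \<omega> (\<delta> \<omega>))) = 0"
proof -
  \<comment> \<open>\<open>c i k\<close> is the component of \<open>W i\<close> along
    \<open>\<psi> k\<close>, and \<open>z k\<close> collects these components against the
    \<open>A i\<close>. It would be the zero function if the \<open>A i\<close> were independent;
    here it is only shown to be null for \<open>B\<close>.\<close>
  define c where "c i k = (\<Sum>\<omega>\<in>S. lam \<omega> * W i \<omega> * \<psi> k \<omega>)" for i k
  define z where "z k = (\<lambda>x. \<Sum>i\<in>UNIV. c i k * A i x)" for k
  have z: "z k \<in> V" for k unfolding z_def by (rule subspace_sum[OF V]) (auto intro: A)
  have Bz: "B u (z k) = (\<Sum>i\<in>UNIV. c i k * B u (A i))" if "u \<in> V" for u k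
    unfolding z_def by (rule linear_on_space_sum[OF V B[OF that]]) (auto intro: A)
  have Gz: "G \<omega> (z k) = (\<Sum>i\<in>UNIV. c i k * G \<omega> (A i))" if "\<omega> \<in> S" for \<omega> k
    unfolding z_def by (rule linear_on_space_sum[OF V G[OF that]]) (auto intro: A)
  \<comment> \<open>Pairing \<open>stoch\<close> with \<open>\<psi> k\<close> removes
    \<open>q\<close> by orthogonality and leaves the Gram matrix of the \<open>A i\<close> applied
    to the coefficients \<open>c i k\<close>.\<close>
  have "B (A j) (z k) = 0" for j k
  proof -
    have "B (A j) (z k) = (\<Sum>i\<in>UNIV. \<Sum>\<omega>\<in>S. lam \<omega> * \<psi> k \<omega> * (W i \<omega> * B (A i) (A j)))"
      unfolding Bz[OF A] c_def sum_distrib_right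
      by (intro sum.cong refl) (simp add: sym[of "A j"] mult_ac)
    also have "\<dots> = (\<Sum>\<omega>\<in>S. lam \<omega> * \<psi> k \<omega> * (\<Sum>i\<in>UNIV. W i \<omega> * B (A i) (A j)))"
      by (subst sum.swap) (simp add: sum_distrib_left)
    also have "\<dots> = (\<Sum>\<omega>\<in>S. - dt * (lam \<omega> * q j \<omega> * \<psi> k \<omega>))"
    proof (rule sum.cong)
      fix \<omega> assume "\<omega> \<in> S"
      then have "(\<Sum>i\<in>UNIV. W i \<omega> * B (A i) (A j)) = - dt * q j \<omega>"
        using stoch[of \<omega> j] dt by (simp add: field_simps add_eq_0_iff)
      then show "lam \<omega> * \<psi> k \<omega> * (\<Sum>i\<in>UNIV. W i \<omega> * B (A i) (A j)) = - dt * (lam \<omega> * q j \<omega> * \<psi> k \<omega>)"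
        by simp
    qed simp
    also have "\<dots> = 0" unfolding sum_distrib_left[symmetric] by (simp add: qorth)
    finally show ?thesis .
  qed
  \<comment> \<open>\<open>z k\<close> is a combination of the \<open>A j\<close>, to all of which
    it is orthogonal.\<close>
  then have Bzz: "B (z k) (z k) = 0" for k
    unfolding Bz[OF z] sym[of "z k" "A _"] by simp
  have N1: "(\<Sum>i\<in>UNIV. c i k * B u (A i)) = 0" if "u \<in> V" for u k
    using nullB[OF that z Bzz] Bz[OF that] by simp
  have N2: "(\<Sum>i\<in>UNIV. c i k * G \<omega> (A i)) = 0" if "\<omega> \<in> S" for \<omega> k
    using nullG[OF that z Bzz] Gz[OF that] by simp
  have sumV: "(\<lambda>x. \<Sum>k\<in>UNIV. \<psi> k \<omega> * X k x) \<in> V" "(\<lambda>x. \<Sum>i\<in>UNIV. W i \<omega> * A i x) \<in> V" for \<omega>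
    by (auto intro!: subspace_sum[OF V] X A)
  have L\<delta>: "L (\<delta> \<omega>) = (\<Sum>k\<in>UNIV. \<psi> k \<omega> * L (X k)) + (\<Sum>i\<in>UNIV. W i \<omega> * L (A i))"
    if "linear_on_space V L" "\<omega> \<in> S" for L \<omega>
    using linear_on_space_add[OF that(1) sumV(1)[of \<omega>] sumV(2)[of \<omega>]] linear_on_space_sum[OF V that(1), of UNIV X]
      linear_on_space_sum[OF V that(1), of UNIV A]
    by (simp add: \<delta>[OF that(2)] X A)
  have \<delta>V: "\<delta> \<omega> \<in> V" if "\<omega> \<in> S" for \<omega>
    using subspace_add_scale[OF V sumV(1)[of \<omega>] sumV(2)[of \<omega>], of 1] by (simp add: \<delta>[OF that])
  \<comment> \<open>The residual of the Galerkin equation at one sample point. It is tested below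
    against the two families making up \<open>\<delta>\<close>: elements of \<open>V\<close> times
    \<open>\<psi> l\<close> (\<open>R1\<close>), and the \<open>A j\<close> times \<open>W j\<close>
    (\<open>R2\<close>).\<close>
  define res where "res \<omega> v = B (\<delta> \<omega>) v / dt + G \<omega> v" for \<omega> v
  have res: "res \<omega> v = ((\<Sum>k\<in>UNIV. \<psi> k \<omega> * B (X k) v) + (\<Sum>i\<in>UNIV. W i \<omega> * B (A i) v)) / dt + G \<omega> v"
    if "\<omega> \<in> S" "v \<in> V" for \<omega> v
    unfolding res_def sym[of "\<delta> \<omega>" v] L\<delta>[OF B[OF that(2)] that(1)] by (simp only: sym[of v])
  \<comment> \<open>Orthonormality singles out \<open>X l\<close>, the contribution of the
    \<open>W i\<close> becomes the null term of \<open>N1\<close>, and \<open>mean\<close> says that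
    the rest is zero.\<close>
  have R1: "(\<Sum>\<omega>\<in>S. lam \<omega> * \<psi> l \<omega> * res \<omega> v) = 0" if v: "v \<in> V" for l v
  proof -
    have "(\<Sum>\<omega>\<in>S. lam \<omega> * \<psi> l \<omega> * res \<omega> v)
       = (\<Sum>\<omega>\<in>S. (\<Sum>k\<in>UNIV. lam \<omega> * \<psi> k \<omega> * \<psi> l \<omega> * B (X k) v) / dt
           + (\<Sum>i\<in>UNIV. lam \<omega> * W i \<omega> * \<psi> l \<omega> * B (A i) v) / dt + lam \<omega> * (G \<omega> v * \<psi> l \<omega>))"
      by (rule sum.cong) (auto simp: res[OF _ v] sum_distrib_left distrib_left add_divide_distrib sum_divide_distrib mult_ac)
    also have "\<dots> = (\<Sum>k\<in>UNIV. \<Sum>\<omega>\<in>S. lam \<omega> * \<psi> k \<omega> * \<psi> l \<omega> * B (X k) v) / dt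
        + (\<Sum>i\<in>UNIV. \<Sum>\<omega>\<in>S. lam \<omega> * W i \<omega> * \<psi> l \<omega> * B (A i) v) / dt + (\<Sum>\<omega>\<in>S. lam \<omega> * (G \<omega> v * \<psi> l \<omega>))"
      by (simp only: sum.distrib sum_divide_distrib[symmetric] sum.swap[of _ S UNIV])
    also have "\<dots> = (\<Sum>k\<in>UNIV. (if k = l then 1 else 0) * B (X k) v) / dt
        + (\<Sum>i\<in>UNIV. c i l * B v (A i)) / dt + (\<Sum>\<omega>\<in>S. lam \<omega> * (G \<omega> v * \<psi> l \<omega>))"
      by (simp only: sum_distrib_right[symmetric] orth c_def sym[of v])
    also have "(\<Sum>k\<in>UNIV. (if k = l then 1 else 0) * B (X k) v) = B (X l) v"
      by (simp add: if_distrib[of "\<lambda>t. t * _"] cong: if_cong)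
    finally show ?thesis using mean[OF v, of l] N1[OF v, of l] by simp
  qed
  \<comment> \<open>Orthogonality of \<open>q j\<close> to the \<open>\<psi> k\<close> forces the
    subtracted coefficients to be the Fourier coefficients of
    \<open>G \<omega> (A j)\<close>.\<close>
  have e: "e j k = (\<Sum>\<omega>\<in>S. lam \<omega> * \<psi> k \<omega> * G \<omega> (A j))" for j k
  proof -
    have "0 = (\<Sum>\<omega>\<in>S. lam \<omega> * \<psi> k \<omega> * G \<omega> (A j) - (\<Sum>l\<in>UNIV. e j l * (lam \<omega> * \<psi> l \<omega> * \<psi> k \<omega>)))"
      unfolding qorth[of j k, symmetric]
      by (rule sum.cong) (auto simp: q algebra_simps sum_distrib_left)
    also have "\<dots> = (\<Sum>\<omega>\<in>S. lam \<omega> * \<psi> k \<omega> * G \<omega> (A j)) - (\<Sum>l\<in>UNIV. e j l * (if l = k then 1 else 0))"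
      unfolding sum_subtractf by (subst sum.swap) (simp only: sum_distrib_left[symmetric] orth)
    finally show ?thesis by (simp add: if_distrib[of "\<lambda>t. _ * t"] cong: if_cong)
  qed
  \<comment> \<open>By \<open>stoch\<close> the \<open>W\<close> part of the increment cancels the
    component \<open>q j\<close> of \<open>G\<close>, so this residual lies in the span of the
    \<open>\<psi> k\<close>. Pairing it with \<open>W j\<close> therefore produces only the
    coefficients \<open>c j k\<close>, and both resulting sums vanish by \<open>N1\<close> and
    \<open>N2\<close>.\<close>
  have resA: "res \<omega> (A j) = (\<Sum>k\<in>UNIV. \<psi> k \<omega> * (B (X k) (A j) / dt + e j k))" if "\<omega> \<in> S" for \<omega> j
    using stoch[OF that, of j] q[OF that, of j]
    by (simp add: res[OF that A] add_divide_distrib sum_divide_distrib[symmetric] distrib_left sum.distrib mult_ac)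
  have "(\<Sum>j\<in>UNIV. \<Sum>\<omega>\<in>S. lam \<omega> * W j \<omega> * res \<omega> (A j))
      = (\<Sum>j\<in>UNIV. \<Sum>\<omega>\<in>S. \<Sum>k\<in>UNIV. lam \<omega> * W j \<omega> * \<psi> k \<omega> * (B (X k) (A j) / dt + e j k))"
    by (auto simp: resA sum_distrib_left mult_ac intro!: sum.cong)
  also have "\<dots> = (\<Sum>j\<in>UNIV. \<Sum>k\<in>UNIV. c j k * (B (X k) (A j) / dt + e j k))"
    by (simp only: sum.swap[of _ UNIV S] sum_distrib_right[symmetric] c_def)
  also have "\<dots> = (\<Sum>k\<in>UNIV. (\<Sum>j\<in>UNIV. c j k * B (X k) (A j)) / dt + (\<Sum>j\<in>UNIV. c j k * e j k))"
    by (subst sum.swap) (simp add: distrib_left sum.distrib sum_divide_distrib)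
  also have "\<dots> = 0"
  proof -
    have "(\<Sum>j\<in>UNIV. c j k * e j k) = (\<Sum>j\<in>UNIV. \<Sum>\<omega>\<in>S. lam \<omega> * \<psi> k \<omega> * (c j k * G \<omega> (A j)))" for k
      by (simp add: e sum_distrib_left mult_ac)
    also have "\<dots> k = (\<Sum>\<omega>\<in>S. lam \<omega> * \<psi> k \<omega> * (\<Sum>j\<in>UNIV. c j k * G \<omega> (A j)))" for k
      by (subst sum.swap) (simp add: sum_distrib_left)
    also have "\<dots> k = 0" for k using N2 by simp
    finally show ?thesis using N1[OF X] by simp
  qed
  finally have R2: "(\<Sum>j\<in>UNIV. \<Sum>\<omega>\<in>S. lam \<omega> * W j \<omega> * res \<omega> (A j)) = 0" .
  have "res \<omega> (\<delta> \<omega>) = (\<Sum>k\<in>UNIV. \<psi> k \<omega> * res \<omega> (X k)) + (\<Sum>i\<in>UNIV. W i \<omega> * res \<omega> (A i))"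
    if "\<omega> \<in> S" for \<omega>
    unfolding res_def L\<delta>[OF B[OF \<delta>V[OF that]] that] L\<delta>[OF G[OF that] that]
    by (simp add: distrib_left sum.distrib add_divide_distrib sum_divide_distrib)
  then have "(\<Sum>\<omega>\<in>S. lam \<omega> * res \<omega> (\<delta> \<omega>))
      = (\<Sum>\<omega>\<in>S. (\<Sum>k\<in>UNIV. lam \<omega> * \<psi> k \<omega> * res \<omega> (X k)) + (\<Sum>i\<in>UNIV. lam \<omega> * W i \<omega> * res \<omega> (A i)))"
    by (simp add: distrib_left sum_distrib_left mult_ac)
  also have "\<dots> = (\<Sum>k\<in>UNIV. \<Sum>\<omega>\<in>S. lam \<omega> * \<psi> k \<omega> * res \<omega> (X k))
      + (\<Sum>i\<in>UNIV. \<Sum>\<omega>\<in>S. lam \<omega> * W i \<omega> * res \<omega> (A i))"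
    by (simp only: sum.distrib sum.swap[of _ S UNIV])
  also have "\<dots> = 0" using R1[OF X] R2 by simp
  finally show ?thesis by (simp add: res_def)
qed

text \<open>\<open>proj_perp\<close> is a choice, so its defining property must first be shown
  satisfiable: subtracting the Fourier sum of \<open>q\<close> does it, by orthonormality. The
  coefficients \<open>e\<close> are then read off the chosen element, not off this witness.\<close>

lemma proj_perp_decomposition:
  fixes Y :: "'r::finite \<Rightarrow> 'p \<Rightarrow> real"
  assumes orth: "\<And>i j. rho_inner S lam (Y i) (Y j) = (if i = j then 1 else 0)"
  obtains e where "\<And>\<omega>. \<omega> \<in> S \<Longrightarrow> proj_perp S lam (fun_vs.span (range Y)) q \<omega> = q \<omega> - (\<Sum>j\<in>UNIV. e j * Y j \<omega>)"
    and "\<And>j. rho_inner S lam (proj_perp S lam (fun_vs.span (range Y)) q) (Y j) = 0"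
proof -
  \<comment> \<open>An explicit form for the elements of the span, from which coefficients can be
    extracted.\<close>
  let ?T = "{y. \<exists>e. y = (\<lambda>\<omega>. \<Sum>j\<in>UNIV. e j * Y j \<omega>)}"
  have "fun_vs.subspace ?T"
  proof (rule fun_vs.subspaceI)
    show "0 \<in> ?T" by (auto simp: zero_fun_def intro!: exI[of _ "\<lambda>_. 0"])
  next
    fix x y assume "x \<in> ?T" "y \<in> ?T"
    then obtain e e' where "x = (\<lambda>\<omega>. \<Sum>j\<in>UNIV. e j * Y j \<omega>)" "y = (\<lambda>\<omega>. \<Sum>j\<in>UNIV. e' j * Y j \<omega>)" by auto
    then show "x + y \<in> ?T"
      by (auto simp: plus_fun_def distrib_right sum.distrib intro!: exI[of _ "\<lambda>j. e j + e' j"])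
  next
    fix c x assume "x \<in> ?T"
    then obtain e where "x = (\<lambda>\<omega>. \<Sum>j\<in>UNIV. e j * Y j \<omega>)" by auto
    then show "(\<lambda>\<omega>. c * x \<omega>) \<in> ?T"
      by (auto simp: sum_distrib_left mult.assoc intro!: exI[of _ "\<lambda>j. c * e j"])
  qed
  moreover have "range Y \<subseteq> ?T"
  proof clarify
    fix i show "\<exists>e. Y i = (\<lambda>\<omega>. \<Sum>j\<in>UNIV. e j * Y j \<omega>)"
      by (intro exI[of _ "\<lambda>j. if j = i then 1 else 0"]) (simp add: if_distrib[of "\<lambda>t. t * _"] cong: if_cong)
  qed
  ultimately have span: "fun_vs.span (range Y) \<subseteq> ?T" by (intro fun_vs.span_minimal)
  have inner_sum: "rho_inner S lam w (\<lambda>\<omega>. \<Sum>j\<in>UNIV. e j * Y j \<omega>) = (\<Sum>j\<in>UNIV. e j * rho_inner S lam w (Y j))" for w e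
    unfolding rho_inner_def sum_distrib_left by (subst sum.swap) (simp add: mult_ac)
  define c where "c j = rho_inner S lam q (Y j)" for j
  define y where "y = (\<lambda>\<omega>. \<Sum>j\<in>UNIV. c j * Y j \<omega>)"
  have y: "y \<in> fun_vs.span (range Y)"
    unfolding y_def by (rule subspace_sum) (auto intro: fun_vs.span_base)
  have "rho_inner S lam (\<lambda>\<omega>. q \<omega> - y \<omega>) (Y j) = 0" for j
  proof -
    have "rho_inner S lam (\<lambda>\<omega>. q \<omega> - y \<omega>) (Y j) = c j - rho_inner S lam (Y j) y"
      by (simp add: rho_inner_def c_def algebra_simps sum_subtractf)
    also have "rho_inner S lam (Y j) y = c j"
      unfolding y_def inner_sum orth by (simp add: if_distrib[of "\<lambda>t. _ * t"] cong: if_cong)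
    finally show ?thesis by simp
  qed
  then have perp: "rho_inner S lam (\<lambda>\<omega>. q \<omega> - y \<omega>) x = 0" if "x \<in> fun_vs.span (range Y)" for x
    using span that by (auto simp: inner_sum)
  let ?P = "\<lambda>w. (\<forall>y\<in>fun_vs.span (range Y). rho_inner S lam w y = 0) \<and>
      (\<exists>y\<in>fun_vs.span (range Y). \<forall>\<omega>\<in>S. q \<omega> = w \<omega> + y \<omega>)"
  have "?P (\<lambda>\<omega>. q \<omega> - y \<omega>)" using perp y by auto
  then have P: "?P (proj_perp S lam (fun_vs.span (range Y)) q)"
    unfolding proj_perp_def by (rule someI[of ?P])
  then obtain x where x: "x \<in> fun_vs.span (range Y)"
    "\<And>\<omega>. \<omega> \<in> S \<Longrightarrow> q \<omega> = proj_perp S lam (fun_vs.span (range Y)) q \<omega> + x \<omega>" by blast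
  then obtain e where e: "x = (\<lambda>\<omega>. \<Sum>j\<in>UNIV. e j * Y j \<omega>)" using span by blast
  show ?thesis
  proof (rule that)
    show "proj_perp S lam (fun_vs.span (range Y)) q \<omega> = q \<omega> - (\<Sum>j\<in>UNIV. e j * Y j \<omega>)" if "\<omega> \<in> S" for \<omega>
      using x(2)[OF that] by (simp add: e)
    show "rho_inner S lam (proj_perp S lam (fun_vs.span (range Y)) q) (Y j) = 0" for j
      using P by (auto intro: fun_vs.span_base)
  qed
qed

text \<open>The type \<open>'r option\<close> indexes the mean together with the modes:
  \<open>None\<close> stands for the constant \<open>1\<close>, \<open>Some j\<close> for
  \<open>Y j\<close>.\<close>

lemma sum_UNIV_option: "(\<Sum>k\<in>UNIV. f k) = f None + (\<Sum>j\<in>UNIV. f (Some j))"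
  for f :: "'r::finite option \<Rightarrow> real"
  by (simp add: UNIV_option_conv sum.reindex)

section \<open>Energy estimate for one step\<close>

locale random_diffusion =
  fixes D :: "(real ^ 'd) set" and \<Gamma> S :: "'p set" and lam :: "'p \<Rightarrow> real"
    and a :: "real ^ 'd \<Rightarrow> 'p \<Rightarrow> real" and amin amax :: real and V :: "(real ^ 'd \<Rightarrow> real) set"
  assumes D: "D \<in> sets lebesgue" "bounded D"
    and V: "fun_vs.subspace V" "V \<subseteq> H10 D"
    and discrete: "discrete_measure \<Gamma> S lam"
    and coeff: "diffusion_coeff D \<Gamma> amin amax a"
begin

lemma lam_pos: "\<omega> \<in> S \<Longrightarrow> lam \<omega> > 0" and lam_sum: "(\<Sum>\<omega>\<in>S. lam \<omega>) = 1"
  and S_subset: "\<omega> \<in> S \<Longrightarrow> \<omega> \<in> \<Gamma>"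
  using discrete by (auto simp: discrete_measure_def)

lemma V_H10: "v \<in> V \<Longrightarrow> v \<in> H10 D" and V_L2: "v \<in> V \<Longrightarrow> v \<in> L2 D"
  using V(2) by (auto intro: H10_in_L2)

lemma a_measurable: "\<omega> \<in> S \<Longrightarrow> (\<lambda>x. a x \<omega>) \<in> borel_measurable (lebesgue_on D)"
  and a_nonneg: "\<omega> \<in> S \<Longrightarrow> x \<in> D \<Longrightarrow> 0 \<le> a x \<omega>"
  and a_upper: "\<omega> \<in> S \<Longrightarrow> x \<in> D \<Longrightarrow> a x \<omega> \<le> amax"
  using coeff S_subset by (fastforce simp: diffusion_coeff_def)+

lemma a_bar_measurable: "a_bar S lam a \<in> borel_measurable (lebesgue_on D)"
  unfolding a_bar_def expect_def
  by (intro borel_measurable_sum borel_measurable_times borel_measurable_const a_measurable)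

lemma a_bar_bound: "x \<in> D \<Longrightarrow> \<bar>a_bar S lam a x\<bar> \<le> amax"
proof -
  assume x: "x \<in> D"
  have "0 \<le> a_bar S lam a x"
    unfolding a_bar_def expect_def by (intro sum_nonneg) (simp add: lam_pos less_imp_le a_nonneg x)
  moreover have "a_bar S lam a x \<le> (\<Sum>\<omega>\<in>S. lam \<omega> * amax)"
    unfolding a_bar_def expect_def
    by (intro sum_mono mult_left_mono) (auto simp: lam_pos less_imp_le a_upper x)
  ultimately show ?thesis by (simp add: sum_distrib_right[symmetric] lam_sum)
qed

lemma a_stoch_measurable: "\<omega> \<in> S \<Longrightarrow> (\<lambda>x. a_stoch S lam a x \<omega>) \<in> borel_measurable (lebesgue_on D)"
  unfolding a_stoch_def by (intro borel_measurable_diff a_measurable a_bar_measurable)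

lemma a_stoch_bound: "\<omega> \<in> S \<Longrightarrow> x \<in> D \<Longrightarrow> \<bar>a_stoch S lam a x \<omega>\<bar> \<le> 2 * amax"
  using a_bar_bound[of x] a_nonneg[of \<omega> x] a_upper[of \<omega> x] by (auto simp: a_stoch_def)

lemma linear_L2_inner: "u \<in> L2 D \<Longrightarrow> linear_on_space V (L2_inner D u)"
  using L2_inner_scaleR_right[where 'b=real]
  by (auto simp: linear_on_space_def L2_inner_add_right V_L2 L2_cmult)

lemma linear_neg_div:
  assumes "b \<in> borel_measurable (lebesgue_on D)" "\<And>x. x \<in> D \<Longrightarrow> \<bar>b x\<bar> \<le> C" "u \<in> V"
  shows "linear_on_space V (neg_div D b u)"
  unfolding linear_on_space_def
  by (intro ballI allI neg_div_add_scale_right[OF D assms(1,2)] V_H10 subspace_add_scale V(1) assms(3))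

lemmas linear_a_bar = linear_neg_div[OF a_bar_measurable a_bar_bound]
lemmas linear_a_stoch = linear_neg_div[OF a_stoch_measurable a_stoch_bound]

lemma linear_residual:
  assumes "\<omega> \<in> S" "un \<omega> \<in> V" "un1 \<omega> \<in> V" "f \<omega> \<in> L2 D"
  shows "linear_on_space V (residual D S lam a un un1 f \<omega>)"
  using linear_a_bar[OF _ assms(3)] linear_a_stoch[OF assms(1) assms(1) _ assms(2)] linear_L2_inner[OF assms(4)]
  by (simp add: linear_on_space_def residual_def algebra_simps)

lemma L2_inner_null:
  assumes "v \<in> V" "L2_inner D v v = 0"
  shows "L2_inner D u v = 0"
proof -
  have "AE x in lebesgue_on D. v x = 0" using L2_inner_self_eq_0_iff[OF V_L2] assms by simp
  then show ?thesis unfolding L2_inner_def by (intro integral_eq_zero_AE) auto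
qed

text \<open>A function of zero \<open>L2\<close> norm also has zero gradient almost everywhere, so
  the residual, although not bounded by the \<open>L2\<close> norm through its formula, cannot see
  it.\<close>

lemma residual_null:
  assumes "v \<in> V" "L2_inner D v v = 0"
  shows "residual D S lam a un un1 f \<omega> v = 0"
proof -
  have "AE x in lebesgue_on D. v x = 0" using L2_inner_self_eq_0_iff[OF V_L2] assms by simp
  then show ?thesis
    by (simp add: residual_def neg_div_eq_0_AE[OF D V_H10[OF assms(1)]] L2_inner_null[OF assms])
qed

lemma dlr_fun_in_V:
  assumes "dlr_state S lam V ub U Y"
  shows "dlr_fun ub U Y \<omega> \<in> V"
proof -
  have "(\<lambda>x. \<Sum>j\<in>UNIV. Y j \<omega> * U j x) \<in> V"
    using assms by (intro subspace_sum V(1)) (auto simp: dlr_state_def)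
  then have "(\<lambda>x. ub x + 1 * (\<Sum>j\<in>UNIV. Y j \<omega> * U j x)) \<in> V"
    using assms by (intro subspace_add_scale V(1)) (auto simp: dlr_state_def)
  also have "(\<lambda>x. ub x + 1 * (\<Sum>j\<in>UNIV. Y j \<omega> * U j x)) = dlr_fun ub U Y \<omega>"
    by (simp add: dlr_fun_def fun_eq_iff mult.commute)
  finally show ?thesis .
qed

text \<open>Instance of \<open>increment_test\<close> with the \<open>L2\<close> inner product as
  \<open>B\<close>. The reorthonormalised modes enter only through the sum that they represent, so
  they can be replaced by \<open>Ut\<close> and \<open>Yt\<close>.\<close>

lemma dlr_step_increment_test:
  fixes U U1 :: "'r::finite \<Rightarrow> real ^ 'd \<Rightarrow> real"
  assumes step: "dlr_step D S lam a V dt f ub U Y ub1 U1 Y1" and dt: "dt \<noteq> 0"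
    and f: "\<And>\<omega>. \<omega> \<in> S \<Longrightarrow> f \<omega> \<in> L2 D"
  defines "u \<equiv> dlr_fun ub U Y" and "u1 \<equiv> dlr_fun ub1 U1 Y1"
  shows "(\<Sum>\<omega>\<in>S. lam \<omega> * (L2_inner D (\<lambda>x. u1 \<omega> x - u \<omega> x) (\<lambda>x. u1 \<omega> x - u \<omega> x) / dt
      + residual D S lam a u u1 f \<omega> (\<lambda>x. u1 \<omega> x - u \<omega> x))) = 0"
proof -
  define G where "G = residual D S lam a u u1 f"
  have st: "dlr_state S lam V ub U Y" "dlr_state S lam V ub1 U1 Y1"
    and mean: "\<And>v. v \<in> V \<Longrightarrow> L2_inner D (\<lambda>x. (ub1 x - ub x) / dt) v + expect S lam (\<lambda>\<omega>. G \<omega> v) = 0"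
    using step unfolding dlr_step_def Let_def G_def u_def u1_def by blast+
  obtain Ut Yt where Ut: "\<And>j. Ut j \<in> V"
    and det: "\<And>j v. v \<in> V \<Longrightarrow> L2_inner D (\<lambda>x. (Ut j x - U j x) / dt) v + expect S lam (\<lambda>\<omega>. G \<omega> v * Y j \<omega>) = 0"
    and stoch: "stoch_eq D S lam dt G Ut Y Yt"
    and repr: "\<And>\<omega> x. \<omega> \<in> S \<Longrightarrow> (\<Sum>j\<in>UNIV. Y1 j \<omega> * U1 j x) = (\<Sum>j\<in>UNIV. Yt j \<omega> * Ut j x)"
    using step unfolding dlr_step_def Let_def G_def u_def u1_def by blast
  have orthY: "\<And>i j. rho_inner S lam (Y i) (Y j) = (if i = j then 1 else 0)"
    and meanY: "\<And>j. expect S lam (Y j) = 0" and UV: "ub \<in> V" "ub1 \<in> V" "\<And>j. U j \<in> V"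
    using st by (auto simp: dlr_state_def)
  define EG where "EG j = expect S lam (\<lambda>\<zeta>. G \<zeta> (Ut j))" for j
  define q where "q j = proj_perp S lam (fun_vs.span (range Y)) (\<lambda>\<eta>. G \<eta> (Ut j) - EG j)" for j
  have "\<exists>e. (\<forall>\<omega>\<in>S. q j \<omega> = G \<omega> (Ut j) - EG j - (\<Sum>i\<in>UNIV. e i * Y i \<omega>)) \<and>
      (\<forall>i. rho_inner S lam (q j) (Y i) = 0)" for j
    unfolding q_def
    by (rule proj_perp_decomposition[OF orthY, where q = "\<lambda>\<eta>. G \<eta> (Ut j) - EG j"]) blast
  then obtain e where e: "\<And>j \<omega>. \<omega> \<in> S \<Longrightarrow> q j \<omega> = G \<omega> (Ut j) - EG j - (\<Sum>i\<in>UNIV. e j i * Y i \<omega>)"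
    and qY: "\<And>j i. rho_inner S lam (q j) (Y i) = 0" by metis
  \<comment> \<open>Zero mean of the \<open>Y j\<close> and total weight one make \<open>1\<close>
    together with the \<open>Y j\<close> an orthonormal system. Centering \<open>G\<close> is then
    the removal of its component along \<open>1\<close>, with coefficient
    \<open>EG j\<close>.\<close>
  define \<psi> where "\<psi> = case_option (\<lambda>_. 1) Y"
  define X where "X = case_option (\<lambda>x. ub1 x - ub x) (\<lambda>j x. Ut j x - U j x)"
  define W where "W j \<omega> = Yt j \<omega> - Y j \<omega>" for j \<omega>
  have scale: "L2_inner D (\<lambda>x. v x / dt) w = L2_inner D v w / dt" for v w :: "real ^ 'd \<Rightarrow> real"
    using L2_inner_scaleR_left[of D "1 / dt" v w] by simp
  show ?thesis
    unfolding G_def[symmetric]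
  proof (rule increment_test[where V = V and B = "L2_inner D" and G = G and \<psi> = \<psi> and X = X and A = Ut
        and W = W and q = q and e = "\<lambda>j. case_option (EG j) (e j)"])
    show "fun_vs.subspace V" by (rule V(1))
    show "linear_on_space V (L2_inner D u)" if "u \<in> V" for u
      by (rule linear_L2_inner[OF V_L2[OF that]])
    show "L2_inner D u v = L2_inner D v u" for u v :: "real ^ 'd \<Rightarrow> real" by (rule L2_inner_commute)
    show "linear_on_space V (G \<omega>)" if "\<omega> \<in> S" for \<omega>
      unfolding G_def u_def u1_def by (intro linear_residual that dlr_fun_in_V st f)
    show "L2_inner D u v = 0" if "v \<in> V" "L2_inner D v v = 0" for u v
      by (rule L2_inner_null[OF that])
    show "G \<omega> v = 0" if "v \<in> V" "L2_inner D v v = 0" for \<omega> v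
      unfolding G_def by (rule residual_null[OF that])
    show "(\<Sum>\<omega>\<in>S. lam \<omega> * \<psi> k \<omega> * \<psi> l \<omega>) = (if k = l then 1 else 0)" for k l
      using orthY meanY lam_sum
      by (auto simp: \<psi>_def rho_inner_def expect_def mult_ac split: option.split)
    show "X k \<in> V" for k
      by (cases k) (auto simp: X_def intro!: subspace_diff_fun V(1) UV Ut)
    show "Ut j \<in> V" for j by (rule Ut)
    show "dt \<noteq> 0" by (rule dt)
    show "L2_inner D (X k) v / dt + (\<Sum>\<omega>\<in>S. lam \<omega> * (G \<omega> v * \<psi> k \<omega>)) = 0" if "v \<in> V" for k v
      using mean[OF that] det[OF that] by (cases k) (auto simp: X_def \<psi>_def scale expect_def)
    show "(\<Sum>i\<in>UNIV. W i \<omega> * L2_inner D (Ut i) (Ut j)) / dt + q j \<omega> = 0" if "\<omega> \<in> S" for \<omega> j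
    proof -
      have "((\<chi> j. (Yt j \<omega> - Y j \<omega>) / dt) v* gram D Ut + (\<chi> j. q j \<omega>)) $ j = 0"
        using stoch that unfolding stoch_eq_def q_def EG_def by simp
      then show ?thesis
        by (simp add: vector_matrix_mult_def gram_def W_def sum_divide_distrib mult_ac)
    qed
    show "q j \<omega> = G \<omega> (Ut j) - (\<Sum>k\<in>UNIV. case_option (EG j) (e j) k * \<psi> k \<omega>)" if "\<omega> \<in> S" for \<omega> j
      by (simp add: e[OF that] sum_UNIV_option \<psi>_def)
    show "(\<Sum>\<omega>\<in>S. lam \<omega> * q j \<omega> * \<psi> k \<omega>) = 0" for j k
    proof (cases k)
      case None
      \<comment> \<open>Orthogonality to \<open>1\<close> is not part of the projection onto the
        complement of the span of \<open>Y\<close>; it comes from the centering of \<open>G\<close>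
        and the zero mean of the \<open>Y i\<close>.\<close>
      have "(\<Sum>\<omega>\<in>S. lam \<omega> * q j \<omega>)
        = (\<Sum>\<omega>\<in>S. lam \<omega> * G \<omega> (Ut j) - lam \<omega> * EG j - (\<Sum>i\<in>UNIV. e j i * (lam \<omega> * Y i \<omega>)))"
        by (intro sum.cong refl) (simp add: e right_diff_distrib sum_distrib_left mult_ac)
      also have "\<dots> = EG j - EG j - (\<Sum>i\<in>UNIV. e j i * expect S lam (Y i))"
        unfolding sum_subtractf sum_distrib_right[symmetric] lam_sum sum.swap[of _ UNIV S]
        by (simp add: EG_def expect_def sum_distrib_left)
      finally show ?thesis using None by (simp add: \<psi>_def meanY)
    next
      case (Some i)
      then show ?thesis using qY[of j i] by (simp add: \<psi>_def rho_inner_def)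
    qed
    show "(\<lambda>x. u1 \<omega> x - u \<omega> x) = (\<lambda>x. (\<Sum>k\<in>UNIV. \<psi> k \<omega> * X k x) + (\<Sum>i\<in>UNIV. W i \<omega> * Ut i x))"
      if "\<omega> \<in> S" for \<omega>
    proof
      fix x
      have "u1 \<omega> x - u \<omega> x = ub1 x + (\<Sum>j\<in>UNIV. Y1 j \<omega> * U1 j x) - (ub x + (\<Sum>j\<in>UNIV. Y j \<omega> * U j x))"
        by (simp add: u_def u1_def dlr_fun_def mult.commute)
      then show "u1 \<omega> x - u \<omega> x = (\<Sum>k\<in>UNIV. \<psi> k \<omega> * X k x) + (\<Sum>i\<in>UNIV. W i \<omega> * Ut i x)"
        unfolding repr[OF that]
        by (simp add: sum_UNIV_option \<psi>_def X_def W_def algebra_simps sum.distrib sum_subtractf)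
    qed
  qed
qed

lemma neg_div_decomposition:
  assumes "\<omega> \<in> S" "v \<in> V" "w \<in> V"
  shows "neg_div D (\<lambda>x. a x \<omega>) v w
    = neg_div D (a_bar S lam a) v w + neg_div D (\<lambda>x. a_stoch S lam a x \<omega>) v w"
  using neg_div_add_coeff[OF D(1) V_H10[OF assms(2)] V_H10[OF assms(3)] a_bar_measurable a_bar_bound
      a_stoch_measurable[OF assms(1)] a_stoch_bound[OF assms(1)]]
  by (simp add: a_stoch_def)

text \<open>The two polarisations differ in sign: evaluation at the new state gives
  \<open>2 P(w,d) = P(w,w) - P(v,v) + P(d,d)\<close>, evaluation at the old one
  \<open>2 Q(v,d) = Q(w,w) - Q(v,v) - Q(d,d)\<close>. The implicit mean part must dissipate at least
  what the explicit part produces.\<close>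

lemma semi_implicit_energy_bound:
  assumes dom: "mean_dominates D \<Gamma> S lam a" and \<omega>: "\<omega> \<in> S" and vw: "v \<in> V" "w \<in> V"
  defines "d \<equiv> \<lambda>x. w x - v x"
  shows "neg_div D (\<lambda>x. a x \<omega>) w w - neg_div D (\<lambda>x. a x \<omega>) v v
    \<le> 2 * (neg_div D (a_bar S lam a) w d + neg_div D (\<lambda>x. a_stoch S lam a x \<omega>) v d)"
proof -
  let ?P = "neg_div D (a_bar S lam a)" and ?Q = "neg_div D (\<lambda>x. a_stoch S lam a x \<omega>)"
  let ?b = "\<lambda>x. a_bar S lam a x - a_stoch S lam a x \<omega>"
  have d: "d \<in> V" unfolding d_def by (intro subspace_diff_fun V(1) vw)
  have b: "?b \<in> borel_measurable (lebesgue_on D)" "\<And>x. x \<in> D \<Longrightarrow> \<bar>?b x\<bar> \<le> amax + 2 * amax"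
    using a_bar_bound a_stoch_bound[OF \<omega>] a_bar_measurable a_stoch_measurable[OF \<omega>]
    by (force intro!: borel_measurable_diff)+
  have "0 \<le> neg_div D ?b d d"
    using dom S_subset[OF \<omega>] by (intro neg_div_nonneg D(1)) (auto simp: mean_dominates_def)
  \<comment> \<open>Additivity is applied to \<open>?b\<close> plus the fluctuation, whose sum is
    the mean coefficient.\<close>
  also have "neg_div D ?b d d = ?P d d - ?Q d d"
    using neg_div_add_coeff[OF D(1) V_H10[OF d] V_H10[OF d] b a_stoch_measurable[OF \<omega>] a_stoch_bound[OF \<omega>]]
    by simp
  finally have pos: "?Q d d \<le> ?P d d" by simp
  have P: "?P z d = ?P z w - ?P z v" if "z \<in> V" for z
    unfolding d_def by (rule linear_on_space_diff[OF linear_a_bar[OF _ that] vw(2,1)])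
  have Q: "?Q z d = ?Q z w - ?Q z v" if "z \<in> V" for z
    unfolding d_def by (rule linear_on_space_diff[OF linear_a_stoch[OF \<omega> \<omega> _ that] vw(2,1)])
  have "?P d d = ?P w w - 2 * ?P w v + ?P v v"
    using P[OF d] P[OF vw(1)] P[OF vw(2)] neg_div_commute[of D _ d w] neg_div_commute[of D _ d v]
      neg_div_commute[of D _ v w] by simp
  moreover have "?Q d d = ?Q w w - 2 * ?Q w v + ?Q v v"
    using Q[OF d] Q[OF vw(1)] Q[OF vw(2)] neg_div_commute[of D _ d w] neg_div_commute[of D _ d v]
      neg_div_commute[of D _ v w] by simp
  ultimately show ?thesis
    using pos P[OF vw(2)] Q[OF vw(1)] neg_div_commute[of D _ v w]
    unfolding neg_div_decomposition[OF \<omega> vw(1,1)] neg_div_decomposition[OF \<omega> vw(2,2)]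
    by simp
qed

lemma L_rho_norm_power2: "(L_rho_norm D S lam a v)\<^sup>2 = (\<Sum>\<omega>\<in>S. lam \<omega> * neg_div D (\<lambda>x. a x \<omega>) (v \<omega>) (v \<omega>))"
proof -
  have "0 \<le> (\<Sum>\<omega>\<in>S. lam \<omega> * neg_div D (\<lambda>x. a x \<omega>) (v \<omega>) (v \<omega>))"
    by (intro sum_nonneg mult_nonneg_nonneg neg_div_nonneg D(1) a_nonneg) (auto simp: lam_pos less_imp_le)
  then show ?thesis by (simp add: L_rho_norm_def L_rho_inner_def neg_div_def)
qed

lemma H_rho_norm_power2: "(H_rho_norm D S lam v)\<^sup>2 = (\<Sum>\<omega>\<in>S. lam \<omega> * L2_inner D (v \<omega>) (v \<omega>))"
proof -
  have "0 \<le> (\<Sum>\<omega>\<in>S. lam \<omega> * L2_inner D (v \<omega>) (v \<omega>))"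
    by (intro sum_nonneg mult_nonneg_nonneg L2_inner_self_nonneg) (simp add: lam_pos less_imp_le)
  then show ?thesis by (simp add: H_rho_norm_def L2_norm_power2)
qed

lemma dlr_step_energy:
  fixes U U1 :: "'r::finite \<Rightarrow> real ^ 'd \<Rightarrow> real"
  assumes step: "dlr_step D S lam a V dt f ub U Y ub1 U1 Y1" and dt: "dt > 0"
    and f: "\<And>\<omega>. \<omega> \<in> S \<Longrightarrow> f \<omega> \<in> L2 D" and dom: "mean_dominates D \<Gamma> S lam a"
  shows "(L_rho_norm D S lam a (dlr_fun ub1 U1 Y1))\<^sup>2
    \<le> (L_rho_norm D S lam a (dlr_fun ub U Y))\<^sup>2 + dt / 2 * (H_rho_norm D S lam f)\<^sup>2"
proof -
  define u where "u = dlr_fun ub U Y"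
  define u1 where "u1 = dlr_fun ub1 U1 Y1"
  define d where "d \<omega> = (\<lambda>x. u1 \<omega> x - u \<omega> x)" for \<omega>
  have st: "dlr_state S lam V ub U Y" "dlr_state S lam V ub1 U1 Y1"
    using step unfolding dlr_step_def Let_def by blast+
  then have uV: "u \<omega> \<in> V" "u1 \<omega> \<in> V" for \<omega> by (simp_all add: u_def u1_def dlr_fun_in_V)
  then have dV: "d \<omega> \<in> V" for \<omega> unfolding d_def by (intro subspace_diff_fun V(1))
  let ?E = "\<lambda>v \<omega>. neg_div D (\<lambda>x. a x \<omega>) (v \<omega>) (v \<omega>)"
  \<comment> \<open>Young's inequality with weight \<open>dt\<close> produces exactly the
    \<open>L2_inner D (d \<omega>) (d \<omega>) / dt\<close> present on the right, so the increment
    is used up and \<open>dt / 4\<close>, doubled, remains on the forcing.\<close>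
  have "?E u1 \<omega> - ?E u \<omega> - dt / 2 * L2_inner D (f \<omega>) (f \<omega>)
      \<le> 2 * (L2_inner D (d \<omega>) (d \<omega>) / dt + residual D S lam a u u1 f \<omega> (d \<omega>))" if \<omega>: "\<omega> \<in> S" for \<omega>
    using semi_implicit_energy_bound[OF dom \<omega> uV, of \<omega> \<omega>] L2_young[OF f[OF \<omega>] V_L2[OF dV] dt, of \<omega>]
    by (simp add: residual_def d_def)
  then have "(\<Sum>\<omega>\<in>S. lam \<omega> * (?E u1 \<omega> - ?E u \<omega> - dt / 2 * L2_inner D (f \<omega>) (f \<omega>)))
      \<le> (\<Sum>\<omega>\<in>S. lam \<omega> * (2 * (L2_inner D (d \<omega>) (d \<omega>) / dt + residual D S lam a u u1 f \<omega> (d \<omega>))))"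
    by (intro sum_mono mult_left_mono) (auto simp: lam_pos less_imp_le)
  also have "\<dots> = 2 * (\<Sum>\<omega>\<in>S. lam \<omega> * (L2_inner D (d \<omega>) (d \<omega>) / dt + residual D S lam a u u1 f \<omega> (d \<omega>)))"
    by (simp add: sum_distrib_left mult_ac)
  also have "\<dots> = 0"
    using dlr_step_increment_test[OF step _ f] dt unfolding d_def u_def u1_def by simp
  finally have "(\<Sum>\<omega>\<in>S. lam \<omega> * ?E u1 \<omega>) - (\<Sum>\<omega>\<in>S. lam \<omega> * ?E u \<omega>)
      - dt / 2 * (\<Sum>\<omega>\<in>S. lam \<omega> * L2_inner D (f \<omega>) (f \<omega>)) \<le> 0"
    by (simp add: right_diff_distrib sum_subtractf sum_distrib_left mult_ac)
  then show ?thesis by (simp add: L_rho_norm_power2 H_rho_norm_power2 u_def u1_def)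
qed

end

lemma mean_dominates_symmetric:
  fixes \<Gamma> S :: "(real ^ 'm) set"
  assumes coeff: "diffusion_coeff D \<Gamma> amin amax a" and sym: "\<forall>\<xi>\<in>\<Gamma>. - \<xi> \<in> \<Gamma>"
    and affine: "\<forall>x\<in>D. \<forall>\<xi>\<in>\<Gamma>. a x \<xi> = a_bar S lam a x + (\<Sum>j\<in>UNIV. aj j x * \<xi> $ j)"
  shows "mean_dominates D \<Gamma> S lam a"
  unfolding mean_dominates_def
proof (intro ballI)
  fix x \<xi> assume x: "x \<in> D" "\<xi> \<in> \<Gamma>"
  \<comment> \<open>Reflection flips the sign of the fluctuation, so the coefficient at
    \<open>- \<xi>\<close> is the mean minus the fluctuation at \<open>\<xi>\<close>, and its
    positivity is the claim.\<close>
  then have "- \<xi> \<in> \<Gamma>" using sym by blast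
  then have "0 \<le> a x (- \<xi>)" using coeff x by (fastforce simp: diffusion_coeff_def)
  also have "a x (- \<xi>) = a_bar S lam a x - (\<Sum>j\<in>UNIV. aj j x * \<xi> $ j)"
    using affine x \<open>- \<xi> \<in> \<Gamma>\<close> by (simp add: sum_negf)
  also have "(\<Sum>j\<in>UNIV. aj j x * \<xi> $ j) = a_stoch S lam a x \<xi>"
    using affine x by (simp add: a_stoch_def)
  finally show "a_stoch S lam a x \<xi> \<le> a_bar S lam a x" by simp
qed

section \<open>Summation over the time steps\<close>

theorem proposition6p1:
  fixes D :: "(real ^ 'd) set"
    and \<Gamma> S :: "'p set" and lam :: "'p \<Rightarrow> real"
    and a :: "real ^ 'd \<Rightarrow> 'p \<Rightarrow> real" and amin amax :: real
    and I :: "real set" and \<T> :: "real \<Rightarrow> (real ^ 'd) set set"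
    and Vh :: "real \<Rightarrow> (real ^ 'd \<Rightarrow> real) set" and r :: nat and CI h :: real
    and T dt :: real and N :: nat
    and f :: "real \<Rightarrow> 'p \<Rightarrow> real ^ 'd \<Rightarrow> real" and \<theta> :: "nat \<Rightarrow> real"
    and F :: "nat \<Rightarrow> 'p \<Rightarrow> real ^ 'd \<Rightarrow> real"
    and ub :: "nat \<Rightarrow> real ^ 'd \<Rightarrow> real"
    and U :: "nat \<Rightarrow> 'r::finite \<Rightarrow> real ^ 'd \<Rightarrow> real" and Y :: "nat \<Rightarrow> 'r \<Rightarrow> 'p \<Rightarrow> real"
    and u :: "nat \<Rightarrow> 'p \<Rightarrow> real ^ 'd \<Rightarrow> real"
    and \<Gamma>' S' :: "(real ^ 'm) set" and lam' :: "real ^ 'm \<Rightarrow> real"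
    and a' :: "real ^ 'd \<Rightarrow> real ^ 'm \<Rightarrow> real" and amin' amax' :: real
    and aj :: "'m \<Rightarrow> real ^ 'd \<Rightarrow> real"
  assumes dim: "CARD('d) \<le> 3" and D: "polygonal_domain D"
  shows
   "(discrete_measure \<Gamma> S lam \<and> diffusion_coeff D \<Gamma> amin amax a \<and>
     quasi_uniform D I \<T> \<and> (\<forall>h\<in>I. fe_space D (\<T> h) r (Vh h)) \<and>
     (\<forall>h\<in>I. inverse_inequality D S lam (Vh h) CI h) \<and>
     h \<in> I \<and> CARD('r) < fun_vs.dim (Vh h) \<and> CARD('r) < card S \<and>
     T > 0 \<and> N > 0 \<and> dt = T / real N \<and>
     (\<forall>t\<in>{0..T}. \<forall>\<omega>\<in>S. f t \<omega> \<in> L2 D) \<and>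
     (\<forall>n<N. 0 \<le> \<theta> n \<and> \<theta> n \<le> 1) \<and>
     F = (\<lambda>n \<omega> x. (1 - \<theta> n) * f (real n * dt) \<omega> x + \<theta> n * f (real (Suc n) * dt) \<omega> x) \<and>
     u = (\<lambda>n. dlr_fun (ub n) (U n) (Y n)) \<and>
     (\<forall>n<N. dlr_step D S lam a (Vh h) dt (F n) (ub n) (U n) (Y n)
                                        (ub (Suc n)) (U (Suc n)) (Y (Suc n))) \<and>
     mean_dominates D \<Gamma> S lam a
     \<longrightarrow>
     (\<forall>\<kappa>. 0 < \<kappa> \<and> \<kappa> < 2 \<longrightarrow>
        (L_rho_norm D S lam a (u N))\<^sup>2
          \<le> (L_rho_norm D S lam a (u 0))\<^sup>2 + dt / \<kappa> * (\<Sum>n<N. (H_rho_norm D S lam (F n))\<^sup>2)) \<and>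
     ((\<forall>t\<in>{0..T}. \<forall>\<omega>\<in>S. AE x in lebesgue_on D. f t \<omega> x = 0) \<longrightarrow>
        (\<forall>n<N. L_rho_norm D S lam a (u (Suc n)) \<le> L_rho_norm D S lam a (u n))))
    \<and>
    (discrete_measure \<Gamma>' S' lam' \<and> diffusion_coeff D \<Gamma>' amin' amax' a' \<and>
     (\<forall>\<xi>\<in>\<Gamma>'. - \<xi> \<in> \<Gamma>') \<and>
     (\<forall>x\<in>D. \<forall>\<xi>\<in>\<Gamma>'. a' x \<xi> = a_bar S' lam' a' x + (\<Sum>j\<in>UNIV. aj j x * \<xi> $ j))
     \<longrightarrow> mean_dominates D \<Gamma>' S' lam' a')"
proof (intro conjI impI)
  assume asm: "discrete_measure \<Gamma> S lam \<and> diffusion_coeff D \<Gamma> amin amax a \<and>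
     quasi_uniform D I \<T> \<and> (\<forall>h\<in>I. fe_space D (\<T> h) r (Vh h)) \<and>
     (\<forall>h\<in>I. inverse_inequality D S lam (Vh h) CI h) \<and>
     h \<in> I \<and> CARD('r) < fun_vs.dim (Vh h) \<and> CARD('r) < card S \<and>
     T > 0 \<and> N > 0 \<and> dt = T / real N \<and>
     (\<forall>t\<in>{0..T}. \<forall>\<omega>\<in>S. f t \<omega> \<in> L2 D) \<and>
     (\<forall>n<N. 0 \<le> \<theta> n \<and> \<theta> n \<le> 1) \<and>
     F = (\<lambda>n \<omega> x. (1 - \<theta> n) * f (real n * dt) \<omega> x + \<theta> n * f (real (Suc n) * dt) \<omega> x) \<and>
     u = (\<lambda>n. dlr_fun (ub n) (U n) (Y n)) \<and>
     (\<forall>n<N. dlr_step D S lam a (Vh h) dt (F n) (ub n) (U n) (Y n)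
                                        (ub (Suc n)) (U (Suc n)) (Y (Suc n))) \<and>
     mean_dominates D \<Gamma> S lam a"
  have dt: "dt > 0" and dtT: "dt = T / real N" "N > 0" using asm by simp_all
  have FE: "fe_space D (\<T> h) r (Vh h)" using asm by blast
  interpret random_diffusion D \<Gamma> S lam a amin amax "Vh h"
    using asm D FE by unfold_locales
      (auto simp: polygonal_domain_def fe_space_def intro: borel_open)
  \<comment> \<open>The bound includes \<open>n = N\<close>, since the last step may evaluate the
    forcing at its right endpoint \<open>T\<close>.\<close>
  have times: "real n * dt \<in> {0..T}" if "n \<le> N" for n
  proof -
    have "real n * dt \<le> real N * dt" using that dt by (intro mult_right_mono) auto
    moreover have "real N * dt = T" using dtT by simp
    moreover have "0 \<le> real n * dt" using dt by (intro mult_nonneg_nonneg) auto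
    ultimately show ?thesis by simp
  qed
  have F: "F n = (\<lambda>\<omega> x. (1 - \<theta> n) * f (real n * dt) \<omega> x + \<theta> n * f (real (Suc n) * dt) \<omega> x)" for n
    using asm by simp
  have fL2: "f (real n * dt) \<omega> \<in> L2 D" if "n \<le> N" "\<omega> \<in> S" for n \<omega>
    using asm times[OF that(1)] that(2) by blast
  have FL2: "F n \<omega> \<in> L2 D" if "n < N" "\<omega> \<in> S" for n \<omega>
    unfolding F using that by (intro L2_add L2_cmult fL2) auto
  let ?E = "\<lambda>n. (L_rho_norm D S lam a (u n))\<^sup>2"
  have step: "?E (Suc n) \<le> ?E n + dt / 2 * (H_rho_norm D S lam (F n))\<^sup>2" if "n < N" for n
  proof -
    have "u = (\<lambda>n. dlr_fun (ub n) (U n) (Y n))" "mean_dominates D \<Gamma> S lam a"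
      "dlr_step D S lam a (Vh h) dt (F n) (ub n) (U n) (Y n) (ub (Suc n)) (U (Suc n)) (Y (Suc n))"
      using asm that by blast+
    then show ?thesis using dlr_step_energy[OF _ dt FL2[OF that]] by simp
  qed
  show "\<forall>\<kappa>. 0 < \<kappa> \<and> \<kappa> < 2 \<longrightarrow> (L_rho_norm D S lam a (u N))\<^sup>2
      \<le> (L_rho_norm D S lam a (u 0))\<^sup>2 + dt / \<kappa> * (\<Sum>n<N. (H_rho_norm D S lam (F n))\<^sup>2)"
  proof (intro allI impI)
    fix \<kappa> :: real assume \<kappa>: "0 < \<kappa> \<and> \<kappa> < 2"
    have "dt / 2 \<le> dt / \<kappa>" using \<kappa> dt by (intro divide_left_mono) auto
    then have le: "dt / 2 * (H_rho_norm D S lam (F n))\<^sup>2 \<le> dt / \<kappa> * (H_rho_norm D S lam (F n))\<^sup>2" for n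
      by (intro mult_right_mono) auto
    have "?E m \<le> ?E 0 + dt / \<kappa> * (\<Sum>n<m. (H_rho_norm D S lam (F n))\<^sup>2)" if "m \<le> N" for m
      using that
    proof (induction m)
      case (Suc m)
      then have "?E m \<le> ?E 0 + dt / \<kappa> * (\<Sum>n<m. (H_rho_norm D S lam (F n))\<^sup>2)" by simp
      then show ?case
        using step[of m] Suc.prems le[of m] unfolding sum.lessThan_Suc distrib_left by linarith
    qed simp
    then show "?E N \<le> ?E 0 + dt / \<kappa> * (\<Sum>n<N. (H_rho_norm D S lam (F n))\<^sup>2)" by blast
  qed
  show "\<forall>n<N. L_rho_norm D S lam a (u (Suc n)) \<le> L_rho_norm D S lam a (u n)"
    if zero: "\<forall>t\<in>{0..T}. \<forall>\<omega>\<in>S. AE x in lebesgue_on D. f t \<omega> x = 0"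
  proof (intro allI impI)
    fix n assume n: "n < N"
    \<comment> \<open>Zero forcing means zero almost everywhere; the convex combination inherits
      this, which removes the forcing term from the one-step estimate.\<close>
    have "L2_inner D (F n \<omega>) (F n \<omega>) = 0" if "\<omega> \<in> S" for \<omega>
    proof -
      have "AE x in lebesgue_on D. f (real n * dt) \<omega> x = 0" "AE x in lebesgue_on D. f (real (Suc n) * dt) \<omega> x = 0"
        using zero that times[of n] times[of "Suc n"] n by auto
      then have "AE x in lebesgue_on D. F n \<omega> x = 0"
        unfolding F by eventually_elim simp
      then show ?thesis using L2_inner_self_eq_0_iff[OF FL2[OF n that]] by simp
    qed
    then have "?E (Suc n) \<le> ?E n" using step[OF n] by (simp add: H_rho_norm_power2)
    moreover have "0 \<le> L_rho_norm D S lam a (u n)"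
      unfolding L_rho_norm_def L_rho_inner_def using neg_div_nonneg[OF D(1)] a_nonneg lam_pos
      by (auto simp: neg_div_def less_imp_le intro!: sum_nonneg mult_nonneg_nonneg)
    ultimately show "L_rho_norm D S lam a (u (Suc n)) \<le> L_rho_norm D S lam a (u n)"
      by (rule power2_le_imp_le)
  qed
next
  assume "discrete_measure \<Gamma>' S' lam' \<and> diffusion_coeff D \<Gamma>' amin' amax' a' \<and>
     (\<forall>\<xi>\<in>\<Gamma>'. - \<xi> \<in> \<Gamma>') \<and>
     (\<forall>x\<in>D. \<forall>\<xi>\<in>\<Gamma>'. a' x \<xi> = a_bar S' lam' a' x + (\<Sum>j\<in>UNIV. aj j x * \<xi> $ j))"
  then show "mean_dominates D \<Gamma>' S' lam' a'"
    using mean_dominates_symmetric[of D \<Gamma>' amin' amax' a' S' lam' aj] by blast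
qed

end
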